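(* Let $n\geq 3$ be an odd integer and let $m$ be a positive integer. Then there is an infinite family of $(m+1)$-tuples of imaginary quadratic fields of the form $$\left(\mathbb{Q}(\sqrt{d}),\ \mathbb{Q}(\sqrt{d+1^{2}}),\ \mathbb{Q}(\sqrt{d+2^2}),\ \ldots,\ \mathbb{Q}(\sqrt{d+m^{2}})\right),\qquad d\in\mathbb{Z},$$ (that is, there are infinitely many pairwise distinct such tuples) such that the class numbers of all $m+1$ fields in each tuple are divisible by $n$.
   Context: The class number of a number field is the order of the ideal class group of its ring of integers. *)

theory Defs
  imports
    Complex_Main
    "HOL-Algebra.Algebra"
    "HOL-Algebra.Algebraic_Closure_Type"
begin

text \<open>Number fields are realised as subfields of the field of complex numbers.\<close>

abbreviation complex_field :: "complex ring" where
  "complex_field \<equiv> ring_of_type_algebra"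

definition quadratic_field :: "int \<Rightarrow> complex set" where
  "quadratic_field d = generate_field complex_field {csqrt (of_int d)}"

text \<open>A quadratic field is normal over the rationals, so it is imaginary as soon as it
  is not contained in the real numbers.\<close>

definition imaginary_quadratic_field :: "complex set \<Rightarrow> bool" where
  "imaginary_quadratic_field K \<longleftrightarrow>
     subfield K complex_field \<and> ring.dimension complex_field 2 \<rat> K \<and> \<not> K \<subseteq> \<real>"

definition ring_of_integers :: "complex set \<Rightarrow> complex ring" where
  "ring_of_integers K = complex_field \<lparr>carrier := {x \<in> K. algebraic_int x}\<rparr>"

definition fractional_ideal :: "complex set \<Rightarrow> complex set \<Rightarrow> bool" where
  "fractional_ideal K I \<longleftrightarrow>
     I \<subseteq> K \<and>
     (\<exists>c \<in> carrier (ring_of_integers K). c \<noteq> 0 \<and> ideal ((\<lambda>x. c * x) ` I) (ring_of_integers K))"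

text \<open>The inductive set \<open>ideal_prod\<close> consists of the finite nonempty sums of products;
  taken in the ambient field it is also the product of fractional ideals.\<close>

definition fractional_ideal_group :: "complex set \<Rightarrow> complex set monoid" where
  "fractional_ideal_group K =
     \<lparr>carrier = {I. fractional_ideal K I \<and> I \<noteq> {0}},
      monoid.mult = ideal_prod complex_field,
      one = carrier (ring_of_integers K)\<rparr>"

definition principal_fractional_ideals :: "complex set \<Rightarrow> complex set set" where
  "principal_fractional_ideals K =
     {(\<lambda>x. a * x) ` carrier (ring_of_integers K) | a. a \<in> K \<and> a \<noteq> 0}"

definition ideal_class_group :: "complex set \<Rightarrow> complex set set monoid" where
  "ideal_class_group K = fractional_ideal_group K Mod principal_fractional_ideals K"

text \<open>\<open>Coset.order\<close> is the number of elements of the group; the qualifier separates it from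
  the order of a root of a polynomial.\<close>

definition class_number :: "complex set \<Rightarrow> nat" where
  "class_number K = Coset.order (ideal_class_group K)"

end

theory Submission
  imports Defs
begin

text \<open>For a large \<open>y\<close> prime to \<open>t\<close>, put \<open>\<alpha> = (t + w) / 2\<close> with \<open>w\<^sup>2 = t\<^sup>2 - 4 y\<^sup>n < 0\<close>. This is an algebraic integer of
trace \<open>t\<close> and norm \<open>y\<^sup>n\<close>. It is coprime to its conjugate, so the ideal \<open>(\<alpha>)\<close> is the
\<open>n\<close>-th power of an ideal \<open>I\<close>. The class of \<open>I\<close> has order exactly \<open>n\<close>: otherwise
\<open>\<alpha> = \<plusminus>\<beta>\<^sup>s\<close> for an integer \<open>\<beta>\<close> of the field and an odd \<open>s \<ge> 3\<close>, and the expansion of the trace of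
\<open>\<beta>\<^sup>s\<close> modulo the square of the norm of \<open>\<beta>\<close> shows that such a trace cannot be as small as \<open>t\<close>
(\<open>abs_lucas_V_neq\<close>). This is \<open>dvd_class_number\<close>; it assumes that the field contains no
square roots of -1 and -3, so that its only units are \<open>\<plusminus>1\<close>.

To treat all fields of a tuple at once, take \<open>d = - 4 y\<^sup>n\<close> with \<open>y = 4 z\<^sup>n - 1\<close>. For \<open>i \<ge> 1\<close> the
number \<open>d + i\<^sup>2\<close> is \<open>t\<^sup>2 - 4 y\<^sup>n\<close> with \<open>t = i\<close>. For \<open>i = 0\<close>, as \<open>n\<close> is odd, the field of \<open>d\<close> is the field of
\<open>-y = 1 - 4 z\<^sup>n\<close>, so the same criterion applies with \<open>t = 1\<close> and \<open>z\<close> in place of \<open>y\<close>. If \<open>z\<close> is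
divisible by a suitable fixed number, all side conditions hold (\<open>tuple_divisible\<close>).
Choosing the parameters \<open>z\<close> so that the numbers \<open>y\<close> are pairwise coprime makes already the first fields
of the tuples distinct (\<open>quadratic_field_base_neq\<close>).

Lagrange's theorem requires that the class group be a group, which means that fractional ideals are
invertible. For imaginary quadratic fields this has a short direct proof: the product of an ideal with its
conjugate is generated by a rational integer (\<open>ideal_times_conjugate\<close>).\<close>

section \<open>Algebraic integers, traces and norms\<close>

lemma poly_of_int_smult:
  "poly (map_poly of_int (smult c p)) (x :: complex) = of_int c * poly (map_poly of_int p) x"
  by (subst map_poly_smult) auto

lemma poly_of_int_add:
  "poly (map_poly of_int (p + q)) (x :: complex) = poly (map_poly of_int p) x + poly (map_poly of_int q) x"
proof -
  have "map_poly of_int (p + q) = (map_poly of_int p + map_poly of_int q :: complex poly)"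
    by (rule poly_eqI) (auto simp: coeff_map_poly)
  thus ?thesis by simp
qed

lemma poly_of_int_mult:
  "poly (map_poly of_int (p * q)) (x :: complex) = poly (map_poly of_int p) x * poly (map_poly of_int q) x"
proof -
  have "map_poly of_int (p * q) = (map_poly of_int p * map_poly of_int q :: complex poly)"
    by (rule poly_eqI) (auto simp: coeff_map_poly coeff_mult)
  thus ?thesis by simp
qed

lemma common_denominator:
  fixes p q :: complex
  assumes "p \<in> \<rat>" "q \<in> \<rat>"
  obtains d a b :: int where "d > 0" "of_int d * p = of_int a" "of_int d * q = of_int b"
proof -
  obtain a b :: int where p: "b > 0" "p = of_int a / of_int b"
    using assms(1) by (auto elim: Rats_cases')
  obtain c d :: int where q: "d > 0" "q = of_int c / of_int d"
    using assms(2) by (auto elim: Rats_cases')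
  show ?thesis
    by (rule that[of "b * d" "a * d" "c * b"]) (use p q in auto)
qed

text \<open>A form of Gauss's lemma. A nonreal \<open>x\<close> is a root of the quadratic polynomial \<open>Q\<close> that arises from
\<open>(X - x) (X - cnj x)\<close> by clearing denominators with an integer \<open>d\<close>. Pseudo-division shows that \<open>Q\<close>
divides \<open>d\<^sup>k\<close> times the monic integer polynomial \<open>p\<close> of \<open>x\<close>, and as the content is multiplicative and
that of \<open>p\<close> is 1, the content of \<open>Q\<close> must be as large as its leading coefficient \<open>d\<close>. Hence \<open>d\<close>
can be cancelled from \<open>Q\<close>.\<close>

lemma algebraic_int_trace_norm:
  fixes x :: complex
  assumes x: "algebraic_int x" and T: "x + cnj x \<in> \<rat>" and N: "x * cnj x \<in> \<rat>"
  shows "x + cnj x \<in> \<int>" "x * cnj x \<in> \<int>"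
proof -
  have "x + cnj x \<in> \<int> \<and> x * cnj x \<in> \<int>"
  proof (cases "x \<in> \<real>")
    case True
    hence c: "cnj x = x" by (simp add: Reals_cnj_iff)
    have "(x + cnj x) / 2 \<in> \<rat>" by (intro Rats_divide T) simp
    hence "x \<in> \<rat>" by (simp add: c)
    hence "x \<in> \<int>" using x by (rule rational_algebraic_int_is_int[rotated])
    thus ?thesis by (simp add: c)
  next
    case False
    obtain d A B :: int where d: "d > 0" and A: "of_int d * (x + cnj x) = of_int A"
      and B: "of_int d * (x * cnj x) = of_int B"
      using common_denominator[OF T N] by blast
    define Q :: "int poly" where "Q = [:B, -A, d:]"
    have Qdeg: "degree Q = 2" and Qlc: "lead_coeff Q = d" and Q0: "Q \<noteq> 0"
      using d by (auto simp: Q_def)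
    have Qx: "poly (map_poly of_int Q) x = 0"
    proof -
      have "poly (map_poly of_int Q) x = of_int B - of_int A * x + of_int d * x * x"
        using d by (simp add: Q_def map_poly_pCons algebra_simps)
      also have "\<dots> = 0" by (simp flip: A B add: algebra_simps)
      finally show ?thesis .
    qed
    obtain p :: "int poly" where p: "poly (map_poly of_int p) x = 0" "lead_coeff p = 1"
      using x algebraic_int_altdef_ipoly by blast
    obtain H R where HR: "pseudo_divmod p Q = (H, R)" by force
    define k where "k = Suc (degree p) - degree Q"
    have div: "smult (d ^ k) p = Q * H + R"
      using pseudo_divmod(1)[OF Q0 HR] Qlc by (simp add: k_def)
    have Rdeg: "R = 0 \<or> degree R < 2"
      using pseudo_divmod(2)[OF Q0 HR] Qdeg by simp
    have "poly (map_poly of_int R) x = 0"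
      using arg_cong[OF div, of "\<lambda>p. poly (map_poly of_int p) x"] p(1) Qx
      by (simp add: poly_of_int_add poly_of_int_mult poly_of_int_smult)
    moreover obtain r s where R: "R = [:r, s:]"
    proof -
      have "degree R < 2" using Rdeg by auto
      hence "R = [:coeff R 0, coeff R 1:]"
        by (intro poly_eqI) (auto simp: coeff_pCons coeff_eq_0 split: nat.splits)
      thus ?thesis using that by blast
    qed
    ultimately have rs: "of_int r + of_int s * x = 0"
      by (simp add: map_poly_pCons mult.commute)
    have "s = 0"
    proof (rule ccontr)
      assume "s \<noteq> 0"
      have "x = of_int (-r) / of_int s" using rs \<open>s \<noteq> 0\<close> by (simp add: field_simps eq_neg_iff_add_eq_0)
      hence "x \<in> \<real>" by simp
      thus False using False by simp
    qed
    hence "R = 0" using rs R by simp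
    hence eq: "smult (d ^ k) p = Q * H" using div by simp
    \<comment> \<open>Leading coefficients and contents are both multiplicative; comparing the two forces
      content and leading coefficient of \<open>Q\<close> to agree.\<close>
    have lcH: "d ^ k = d * lead_coeff H"
      using arg_cong[OF eq, of lead_coeff] p(2) Qlc d by (simp add: lead_coeff_mult)
    have "content p dvd 1" using content_dvd_coeff[of p "degree p"] p(2) by simp
    hence cp: "content p = 1" by (metis normalize_content normalize_1_iff)
    have "d ^ k = content Q * content H"
      using arg_cong[OF eq, of content] d by (simp add: content_mult cp)
    hence cc: "content Q * content H = d * lead_coeff H" using lcH by simp
    have "content Q dvd d" using content_dvd_coeff[of Q "degree Q"] Qlc by simp
    then obtain a where a: "d = content Q * a" by (elim dvdE)
    have "content H dvd lead_coeff H" by simp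
    then obtain b where b: "lead_coeff H = content H * b" by (elim dvdE)
    have H0: "H \<noteq> 0" using lcH d by auto
    have nz: "content Q * content H \<noteq> 0" using Q0 H0 by simp
    have "content Q * content H = (content Q * a) * (content H * b)"
      using cc unfolding a[symmetric] b[symmetric] .
    hence "content Q * content H * 1 = content Q * content H * (a * b)" by (simp only: mult_ac mult_1_right mult_1_left)
    hence "a * b = 1" using nz by (metis mult_left_cancel)
    hence "a dvd 1" by (metis dvdI)
    hence "d dvd content Q" using a by (metis dvd_refl mult_unit_dvd_iff)
    hence dd: "d dvd coeff Q i" for i using content_dvd_coeff dvd_trans by blast
    have "d dvd A" "d dvd B" using dd[of 1] dd[of 0] by (auto simp: Q_def)
    then obtain A' B' where "A = d * A'" "B = d * B'" by (elim dvdE)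
    hence "x + cnj x = of_int A'" "x * cnj x = of_int B'" using A B d by auto
    thus ?thesis by auto
  qed
  thus "x + cnj x \<in> \<int>" "x * cnj x \<in> \<int>" by auto
qed

lemma root_monic_quadratic:
  fixes x s p :: complex
  assumes "s \<in> \<int>" "p \<in> \<int>" "x\<^sup>2 - s * x + p = 0"
  shows "algebraic_int x"
proof (rule algebraic_int.intros[of "[:p, -s, 1:]"])
  show "\<forall>i. coeff [:p, - s, 1:] i \<in> \<int>"
    using assms by (auto simp: coeff_pCons split: nat.splits)
  show "poly [:p, - s, 1:] x = 0"
    using assms(3) by (simp add: power2_eq_square algebra_simps)
qed simp

text \<open>The locales speak of plain sets of complex numbers, so that the arithmetic below is the arithmetic of
the type \<open>complex\<close> and not that of a record. The second one covers exactly what the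
theory of ideals needs of an imaginary quadratic field: conjugation is an automorphism with
rational fixed points, so \<open>x + cnj x\<close> and \<open>x * cnj x\<close> are the trace and the norm of \<open>x\<close>.\<close>

locale complex_subfield =
  fixes K :: "complex set"
  assumes one_closed: "1 \<in> K"
    and diff_closed: "x \<in> K \<Longrightarrow> y \<in> K \<Longrightarrow> x - y \<in> K"
    and mult_closed: "x \<in> K \<Longrightarrow> y \<in> K \<Longrightarrow> x * y \<in> K"
    and inverse_closed: "x \<in> K \<Longrightarrow> inverse x \<in> K"
begin

lemma zero_closed: "0 \<in> K" using diff_closed[OF one_closed one_closed] by simp
lemma uminus_closed: "x \<in> K \<Longrightarrow> - x \<in> K" using diff_closed[OF zero_closed, of x] by simp
lemma add_closed: "x \<in> K \<Longrightarrow> y \<in> K \<Longrightarrow> x + y \<in> K"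
  using diff_closed[OF _ uminus_closed, of x y] by simp
lemma divide_closed: "x \<in> K \<Longrightarrow> y \<in> K \<Longrightarrow> x / y \<in> K"
  using mult_closed inverse_closed by (simp add: divide_inverse)
lemma of_nat_closed: "of_nat k \<in> K"
  by (induction k) (auto intro: zero_closed one_closed add_closed)
lemma of_int_closed: "of_int k \<in> K"
  by (cases k rule: int_cases2) (auto intro: of_nat_closed uminus_closed)
lemma Rats_closed: "q \<in> \<rat> \<Longrightarrow> q \<in> K"
  by (elim Rats_cases') (auto intro: divide_closed of_int_closed)

end

locale imaginary_quadratic = complex_subfield +
  assumes cnj_closed: "x \<in> K \<Longrightarrow> cnj x \<in> K"
    and real_imp_rat: "x \<in> K \<Longrightarrow> x \<in> \<real> \<Longrightarrow> x \<in> \<rat>"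
begin

definition \<O> :: "complex set" where "\<O> = {x \<in> K. algebraic_int x}"

lemma trace_rat: "x \<in> K \<Longrightarrow> x + cnj x \<in> \<rat>"
  by (intro real_imp_rat add_closed cnj_closed) (auto simp: complex_add_cnj)
lemma norm_rat: "x \<in> K \<Longrightarrow> x * cnj x \<in> \<rat>"
  by (intro real_imp_rat mult_closed cnj_closed) (auto simp: complex_mult_cnj)

lemma integers_iff: "x \<in> \<O> \<longleftrightarrow> x \<in> K \<and> x + cnj x \<in> \<int> \<and> x * cnj x \<in> \<int>"
  using algebraic_int_trace_norm[of x] trace_rat[of x] norm_rat[of x]
        root_monic_quadratic[of "x + cnj x" "x * cnj x" x]
  by (auto simp: \<O>_def power2_eq_square algebra_simps)

lemma integers_subset: "x \<in> \<O> \<Longrightarrow> x \<in> K" by (simp add: \<O>_def)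

text \<open>The one closure property of algebraic integers that is not formal. The traces of \<open>x * cnj y\<close> and of
\<open>x * y\<close> are the two roots of a monic quadratic polynomial: their sum is the product of the traces of
\<open>x\<close> and \<open>y\<close>, and their product is again an integral expression in traces and norms. A rational root
of such a polynomial is an integer.\<close>

lemma trace_product_int:
  assumes "x \<in> \<O>" "y \<in> \<O>"
  shows "x * cnj y + cnj (x * cnj y) \<in> \<int>"
proof -
  let ?T = "x * cnj y + cnj (x * cnj y)"
  note x = assms(1)[unfolded integers_iff] and y = assms(2)[unfolded integers_iff]
  define s where "s = (x + cnj x) * (y + cnj y)"
  define p where "p = ((x + cnj x)\<^sup>2 - 2 * (x * cnj x)) * (y * cnj y) + ((y + cnj y)\<^sup>2 - 2 * (y * cnj y)) * (x * cnj x)"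
  have "s \<in> \<int>" "p \<in> \<int>" unfolding s_def p_def using x y by (auto intro!: Ints_mult Ints_add Ints_diff Ints_power)
  moreover have "?T\<^sup>2 - s * ?T + p = 0"
    by (simp add: s_def p_def power2_eq_square algebra_simps)
  ultimately have "algebraic_int ?T" by (rule root_monic_quadratic)
  moreover have "?T \<in> \<rat>" using x y by (intro trace_rat mult_closed cnj_closed) auto
  ultimately show ?thesis by (rule rational_algebraic_int_is_int)
qed

lemma integers_cnj: "x \<in> \<O> \<Longrightarrow> cnj x \<in> \<O>"
  by (auto simp: \<O>_def intro: cnj_closed)

lemma integers_uminus: "x \<in> \<O> \<Longrightarrow> - x \<in> \<O>"
  by (auto simp: \<O>_def intro: uminus_closed)

lemma integers_of_int: "of_int k \<in> \<O>"
  by (auto simp: \<O>_def intro: of_int_closed)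

lemma integers_0: "0 \<in> \<O>" and integers_1: "1 \<in> \<O>"
  using integers_of_int[of 0] integers_of_int[of 1] by auto

lemma integers_add:
  assumes "x \<in> \<O>" "y \<in> \<O>" shows "x + y \<in> \<O>"
proof -
  note x = assms(1)[unfolded integers_iff] and y = assms(2)[unfolded integers_iff]
  have "(x + y) * cnj (x + y) = x * cnj x + y * cnj y + (x * cnj y + cnj (x * cnj y))"
    by (simp add: algebra_simps)
  also have "\<dots> \<in> \<int>" using x y trace_product_int[OF assms] by (blast intro: Ints_add)
  finally have N: "(x + y) * cnj (x + y) \<in> \<int>" .
  have "x + y + cnj (x + y) = (x + cnj x) + (y + cnj y)" by simp
  also have "\<dots> \<in> \<int>" using x y by (blast intro: Ints_add)
  finally show ?thesis using N x y by (simp only: integers_iff) (auto intro: add_closed)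
qed

lemma integers_mult:
  assumes "x \<in> \<O>" "y \<in> \<O>" shows "x * y \<in> \<O>"
proof -
  note x = assms(1)[unfolded integers_iff] and y = assms(2)[unfolded integers_iff]
  have "(x * y) * cnj (x * y) = (x * cnj x) * (y * cnj y)"
    by (simp add: algebra_simps)
  also have "\<dots> \<in> \<int>" using x y by (blast intro: Ints_mult)
  finally have N: "(x * y) * cnj (x * y) \<in> \<int>" .
  have "x * y + cnj (x * y) = x * cnj (cnj y) + cnj (x * cnj (cnj y))" by simp
  also have "\<dots> \<in> \<int>" using assms by (intro trace_product_int integers_cnj)
  finally show ?thesis using N x y by (simp only: integers_iff) (auto intro: mult_closed)
qed

end

section \<open>Fractional ideals and their products\<close>

lemma complex_field_simps [simp]:
  "carrier complex_field = UNIV" "monoid.mult complex_field = (*)" "one complex_field = 1"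
  "ring.zero complex_field = 0" "add complex_field = (+)"
  by (simp_all add: ring_of_type_algebra_def)

interpretation complex_field: cring complex_field
  by (rule cring_from_type_algebra)

lemma complex_field_a_inv [simp]: "a_inv complex_field x = - x"
  by (rule complex_field.minus_equality) auto

lemma complex_field_m_inv: "x \<noteq> 0 \<Longrightarrow> m_inv complex_field x = inverse x"
  by (rule complex_field.inv_unique'[symmetric]) auto

text \<open>The product is taken in the ambient field and for arbitrary sets, so associativity, scaling and
conjugation follow by induction over sums of products.\<close>

abbreviation set_prod :: "complex set \<Rightarrow> complex set \<Rightarrow> complex set" (infixl "\<odot>" 70) where
  "A \<odot> B \<equiv> ideal_prod complex_field A B"

lemma set_prodI: "a \<in> A \<Longrightarrow> b \<in> B \<Longrightarrow> a * b \<in> A \<odot> B"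
  using ideal_prod.prod[of a A b B complex_field] by simp

lemma set_prod_add: "x \<in> A \<odot> B \<Longrightarrow> y \<in> A \<odot> B \<Longrightarrow> x + y \<in> A \<odot> B"
  using ideal_prod.sum[of x complex_field A B y] by simp

lemma set_prod_induct [consumes 1, case_names prod sum]:
  assumes "x \<in> A \<odot> B"
    and "\<And>a b. a \<in> A \<Longrightarrow> b \<in> B \<Longrightarrow> P (a * b)"
    and "\<And>x y. x \<in> A \<odot> B \<Longrightarrow> y \<in> A \<odot> B \<Longrightarrow> P x \<Longrightarrow> P y \<Longrightarrow> P (x + y)"
  shows "P x"
  using assms(1) by (induction rule: ideal_prod.induct) (use assms in auto)

lemma set_prod_subsetI:
  assumes "\<And>a b. a \<in> A \<Longrightarrow> b \<in> B \<Longrightarrow> a * b \<in> C" "\<And>x y. x \<in> C \<Longrightarrow> y \<in> C \<Longrightarrow> x + y \<in> C"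
  shows "A \<odot> B \<subseteq> C"
proof
  fix x assume "x \<in> A \<odot> B" thus "x \<in> C" by (induction rule: set_prod_induct) (use assms in auto)
qed

lemma set_prod_mono: "A \<subseteq> A' \<Longrightarrow> B \<subseteq> B' \<Longrightarrow> A \<odot> B \<subseteq> A' \<odot> B'"
  by (rule set_prod_subsetI) (auto intro: set_prodI set_prod_add)

lemma set_prod_commute: "A \<odot> B = B \<odot> A"
proof -
  have "A \<odot> B \<subseteq> B \<odot> A" for A B
    by (rule set_prod_subsetI) (metis mult.commute set_prodI, rule set_prod_add)
  thus ?thesis by blast
qed

lemma set_prod_assoc: "(A \<odot> B) \<odot> C = A \<odot> (B \<odot> C)"
proof -
  have *: "(A \<odot> B) \<odot> C \<subseteq> A \<odot> (B \<odot> C)" for A B C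
  proof (rule set_prod_subsetI)
    fix x c assume "x \<in> A \<odot> B" "c \<in> C"
    thus "x * c \<in> A \<odot> (B \<odot> C)"
      by (induction rule: set_prod_induct)
        (auto simp: mult.assoc distrib_right intro: set_prodI set_prod_add)
  qed (rule set_prod_add)
  show ?thesis
    using *[of A B C] *[of C B A] by (simp add: set_prod_commute)
qed

lemma set_prod_scale: "(*) a ` A \<odot> B = (*) a ` (A \<odot> B)"
proof
  show "(*) a ` A \<odot> B \<subseteq> (*) a ` (A \<odot> B)"
    by (rule set_prod_subsetI) (auto simp: mult.assoc intro: set_prodI simp flip: distrib_left intro!: imageI set_prod_add)
  show "(*) a ` (A \<odot> B) \<subseteq> (*) a ` A \<odot> B"
  proof safe
    fix x assume "x \<in> A \<odot> B"
    thus "a * x \<in> (*) a ` A \<odot> B"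
      by (induction rule: set_prod_induct)
        (auto simp: distrib_left simp flip: mult.assoc intro: set_prodI set_prod_add)
  qed
qed

lemma set_prod_cnj: "cnj ` (A \<odot> B) = cnj ` A \<odot> cnj ` B"
proof
  show "cnj ` (A \<odot> B) \<subseteq> cnj ` A \<odot> cnj ` B"
  proof safe
    fix x assume "x \<in> A \<odot> B"
    thus "cnj x \<in> cnj ` A \<odot> cnj ` B"
      by (induction rule: set_prod_induct) (auto intro: set_prodI set_prod_add)
  qed
  show "cnj ` A \<odot> cnj ` B \<subseteq> cnj ` (A \<odot> B)"
    by (rule set_prod_subsetI)
      (auto intro: set_prodI set_prod_add intro!: imageI simp flip: complex_cnj_mult complex_cnj_add)
qed

context imaginary_quadratic begin

text \<open>A fractional ideal is an \<open>\<O>\<close>-submodule of the field with a common denominator. Stating this without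
ring records makes the closure properties accessible to the automation.\<close>

definition fractional :: "complex set \<Rightarrow> bool" where
  "fractional I \<longleftrightarrow> I \<subseteq> K \<and> 0 \<in> I \<and> (\<forall>x\<in>I. \<forall>y\<in>I. x + y \<in> I) \<and> (\<forall>r\<in>\<O>. \<forall>x\<in>I. r * x \<in> I) \<and>
     (\<exists>c\<in>\<O>. c \<noteq> 0 \<and> (\<forall>x\<in>I. c * x \<in> \<O>))"

lemma carrier_ring_of_integers [simp]: "carrier (ring_of_integers K) = \<O>"
  by (simp add: ring_of_integers_def \<O>_def)

lemma ring_of_integers_ops:
  "monoid.mult (ring_of_integers K) = (*)" "add (ring_of_integers K) = (+)"
  "ring.zero (ring_of_integers K) = 0" "one (ring_of_integers K) = 1"
  by (simp_all add: ring_of_integers_def)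

lemma ring_ring_of_integers: "ring (ring_of_integers K)"
  unfolding ring_of_integers_def \<O>_def[symmetric]
  by (intro complex_field.subring_is_ring complex_field.subringI)
    (use integers_1 integers_uminus integers_add integers_mult in auto)

lemma ideal_iff:
  "ideal J (ring_of_integers K) \<longleftrightarrow>
     J \<subseteq> \<O> \<and> 0 \<in> J \<and> (\<forall>x\<in>J. \<forall>y\<in>J. x + y \<in> J) \<and> (\<forall>r\<in>\<O>. \<forall>x\<in>J. r * x \<in> J)"
proof
  assume J: "ideal J (ring_of_integers K)"
  show "J \<subseteq> \<O> \<and> 0 \<in> J \<and> (\<forall>x\<in>J. \<forall>y\<in>J. x + y \<in> J) \<and> (\<forall>r\<in>\<O>. \<forall>x\<in>J. r * x \<in> J)"
  proof (intro conjI ballI)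
    show "J \<subseteq> \<O>" using additive_subgroup.a_subset[OF ideal.axioms(1)[OF J]] by simp
    show "0 \<in> J" using additive_subgroup.zero_closed[OF ideal.axioms(1)[OF J]] by (simp add: ring_of_integers_ops)
    show "x + y \<in> J" if "x \<in> J" "y \<in> J" for x y
      using additive_subgroup.a_closed[OF ideal.axioms(1)[OF J] that] by (simp add: ring_of_integers_ops)
    show "r * x \<in> J" if "r \<in> \<O>" "x \<in> J" for r x
      using ideal.I_l_closed[OF J, of x r] that by (simp add: ring_of_integers_ops)
  qed
next
  assume J: "J \<subseteq> \<O> \<and> 0 \<in> J \<and> (\<forall>x\<in>J. \<forall>y\<in>J. x + y \<in> J) \<and> (\<forall>r\<in>\<O>. \<forall>x\<in>J. r * x \<in> J)"
  interpret R: ring "ring_of_integers K" by (rule ring_ring_of_integers)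
  have inv: "a_inv (ring_of_integers K) x = - x" if "x \<in> \<O>" for x
    by (rule R.minus_equality) (use that integers_uminus in \<open>auto simp: ring_of_integers_ops\<close>)
  show "ideal J (ring_of_integers K)"
  proof (rule idealI)
    show "subgroup J (add_monoid (ring_of_integers K))"
    proof
      fix x assume x: "x \<in> J"
      have "-1 * x \<in> J" using J x integers_uminus[OF integers_1] by blast
      thus "m_inv (add_monoid (ring_of_integers K)) x \<in> J"
        using inv[of x] x J by (auto simp: a_inv_def)
    qed (use J in \<open>auto simp: ring_of_integers_ops\<close>)
  next
    fix a x assume "a \<in> J" "x \<in> carrier (ring_of_integers K)"
    hence "x * a \<in> J" using J by simp
    thus "x \<otimes>\<^bsub>ring_of_integers K\<^esub> a \<in> J" "a \<otimes>\<^bsub>ring_of_integers K\<^esub> x \<in> J"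
      by (simp_all add: ring_of_integers_ops mult.commute)
  qed (rule ring_ring_of_integers)
qed

lemma fractional_ideal_iff: "fractional_ideal K I \<longleftrightarrow> fractional I"
proof
  assume "fractional_ideal K I"
  then obtain c where I: "I \<subseteq> K" and c: "c \<in> \<O>" "c \<noteq> 0" and J: "ideal ((*) c ` I) (ring_of_integers K)"
    by (auto simp: fractional_ideal_def)
  note J = J[unfolded ideal_iff]
  have mem: "c * x \<in> (*) c ` I \<longleftrightarrow> x \<in> I" for x using c by auto
  have "0 \<in> I" using J mem[of 0] by simp
  moreover have "x + y \<in> I" if "x \<in> I" "y \<in> I" for x y
    using J that by (subst mem[symmetric]) (auto simp: distrib_left)
  moreover have "r * x \<in> I" if "r \<in> \<O>" "x \<in> I" for r x
  proof -
    have "r * (c * x) \<in> (*) c ` I" using J that by blast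
    also have "r * (c * x) = c * (r * x)" by simp
    finally show ?thesis using mem by blast
  qed
  moreover have "\<forall>x\<in>I. c * x \<in> \<O>" using J by auto
  ultimately show "fractional I" unfolding fractional_def using I c
    by (intro conjI ballI bexI[of _ c]) auto
next
  assume I: "fractional I"
  then obtain c where c: "c \<in> \<O>" "c \<noteq> 0" "\<forall>x\<in>I. c * x \<in> \<O>" unfolding fractional_def by blast
  have "ideal ((*) c ` I) (ring_of_integers K)"
    unfolding ideal_iff
  proof (intro conjI ballI)
    fix r x assume r: "r \<in> \<O>" and "x \<in> (*) c ` I"
    then obtain y where y: "y \<in> I" "x = c * y" by blast
    have "r * x = c * (r * y)" using y by simp
    thus "r * x \<in> (*) c ` I" using I r y unfolding fractional_def by blast
  qed (use I c in \<open>auto simp: fractional_def simp flip: distrib_left\<close>)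
  thus "fractional_ideal K I" using I c unfolding fractional_ideal_def fractional_def by auto
qed

lemma fractionalD:
  assumes "fractional I"
  shows "x \<in> I \<Longrightarrow> x \<in> K" "0 \<in> I" "x \<in> I \<Longrightarrow> y \<in> I \<Longrightarrow> x + y \<in> I" "r \<in> \<O> \<Longrightarrow> x \<in> I \<Longrightarrow> r * x \<in> I"
  using assms unfolding fractional_def by blast+

lemma fractional_uminus:
  assumes "fractional I" "x \<in> I" shows "- x \<in> I"
  using fractionalD(4)[OF assms(1) integers_uminus[OF integers_1] assms(2)] by simp

lemma fractional_set_prod:
  assumes A: "fractional A" and B: "fractional B"
  shows "fractional (A \<odot> B)"
proof -
  obtain c where c: "c \<in> \<O>" "c \<noteq> 0" "\<forall>x\<in>A. c * x \<in> \<O>" using A unfolding fractional_def by blast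
  obtain d where d: "d \<in> \<O>" "d \<noteq> 0" "\<forall>x\<in>B. d * x \<in> \<O>" using B unfolding fractional_def by blast
  have "A \<odot> B \<subseteq> K"
    by (rule set_prod_subsetI) (auto intro: mult_closed add_closed fractionalD(1)[OF A] fractionalD(1)[OF B])
  moreover have "0 \<in> A \<odot> B"
    using set_prodI[OF fractionalD(2)[OF A] fractionalD(2)[OF B]] by simp
  moreover have "r * x \<in> A \<odot> B" if r: "r \<in> \<O>" and "x \<in> A \<odot> B" for r x
    using that(2)
    by (induction rule: set_prod_induct)
      (auto simp: distrib_left mult.assoc[symmetric] intro!: set_prodI set_prod_add fractionalD(4)[OF A r])
  moreover have "(c * d) * x \<in> \<O>" if "x \<in> A \<odot> B" for x
    using that
  proof (induction rule: set_prod_induct)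
    case (prod a b)
    have "(c * d) * (a * b) = (c * a) * (d * b)" by simp
    thus ?case using integers_mult[of "c * a" "d * b"] prod c d by metis
  next
    case (sum x y)
    thus ?case using integers_add[of "c * d * x" "c * d * y"] by (simp only: distrib_left)
  qed
  ultimately show ?thesis
    unfolding fractional_def using set_prod_add integers_mult[OF c(1) d(1)] c(2) d(2)
    by (intro conjI ballI bexI[of _ "c * d"]) auto
qed

lemma fractional_integers: "fractional \<O>"
  unfolding fractional_def using integers_0 integers_1 integers_add integers_mult integers_subset
  by (intro conjI ballI bexI[of _ 1]) auto

lemma integral_multiple:
  assumes "x \<in> K" obtains d :: int where "d > 0" "of_int d * x \<in> \<O>"
proof -
  obtain d a b :: int where d: "d > 0" "of_int d * (x + cnj x) = of_int a" "of_int d * (x * cnj x) = of_int b"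
    using common_denominator[OF trace_rat[OF assms] norm_rat[OF assms]] by blast
  have 1: "of_int d * x + cnj (of_int d * x) = of_int a" using d(2) by (simp add: distrib_left)
  have "of_int d * x * cnj (of_int d * x) = of_int d * (of_int d * (x * cnj x))" by simp
  hence "of_int d * x * cnj (of_int d * x) = of_int (d * b)" by (simp only: d(3) of_int_mult)
  hence "of_int d * x \<in> \<O>"
    using 1 assms by (simp only: integers_iff) (auto intro: mult_closed of_int_closed)
  thus ?thesis using d(1) that by blast
qed

lemma fractional_scale:
  assumes I: "fractional I" and k: "k \<in> K" "k \<noteq> 0"
  shows "fractional ((*) k ` I)"
proof -
  obtain c where c: "c \<in> \<O>" "c \<noteq> 0" "\<forall>x\<in>I. c * x \<in> \<O>" using I unfolding fractional_def by blast
  obtain d :: int where d: "d > 0" "of_int d * k \<in> \<O>" using integral_multiple[OF k(1)] .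
  have "r * x \<in> (*) k ` I" if r: "r \<in> \<O>" and x: "x \<in> (*) k ` I" for r x
  proof -
    obtain y where y: "y \<in> I" "x = k * y" using x by blast
    have "r * x = k * (r * y)" using y by simp
    thus ?thesis using fractionalD(4)[OF I r y(1)] by blast
  qed
  moreover have "(c * of_int d) * x \<in> \<O>" if x: "x \<in> (*) k ` I" for x
  proof -
    obtain y where y: "y \<in> I" "x = k * y" using x by blast
    have "(c * of_int d) * x = (of_int d * k) * (c * y)" using y by simp
    thus ?thesis using integers_mult[OF d(2), of "c * y"] c y(1) by metis
  qed
  moreover have "c * of_int d \<in> \<O>" "c * of_int d \<noteq> 0"
    using integers_mult[OF c(1) integers_of_int[of d]] c(2) d(1) by auto
  ultimately show ?thesis
    unfolding fractional_def using I k
    by (intro conjI ballI bexI[of _ "c * of_int d"])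
      (auto intro: mult_closed fractionalD simp flip: distrib_left)
qed

lemma fractional_cnj:
  assumes I: "fractional I" shows "fractional (cnj ` I)"
proof -
  obtain c where c: "c \<in> \<O>" "c \<noteq> 0" "\<forall>x\<in>I. c * x \<in> \<O>" using I unfolding fractional_def by blast
  have "r * x \<in> cnj ` I" if r: "r \<in> \<O>" and x: "x \<in> cnj ` I" for r x
  proof -
    obtain y where y: "y \<in> I" "x = cnj y" using x by blast
    have "r * x = cnj (cnj r * y)" using y by simp
    thus ?thesis using fractionalD(4)[OF I integers_cnj[OF r] y(1)] by blast
  qed
  moreover have "cnj c * x \<in> \<O>" if x: "x \<in> cnj ` I" for x
  proof -
    obtain y where y: "y \<in> I" "x = cnj y" using x by blast
    thus ?thesis using integers_cnj[of "c * y"] c y(1) by (metis complex_cnj_mult)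
  qed
  moreover have "x + y \<in> cnj ` I" if "x \<in> cnj ` I" "y \<in> cnj ` I" for x y
    using that fractionalD(3)[OF I] by (auto simp flip: complex_cnj_add)
  ultimately show ?thesis
    unfolding fractional_def using I integers_cnj[OF c(1)] c(2)
    by (intro conjI ballI bexI[of _ "cnj c"]) (auto intro: cnj_closed fractionalD integers_subset image_eqI[of _ _ 0])
qed

lemma set_prod_integers: 
  assumes I: "fractional I" shows "\<O> \<odot> I = I"
proof
  show "\<O> \<odot> I \<subseteq> I" by (rule set_prod_subsetI) (use fractionalD[OF I] in auto)
  show "I \<subseteq> \<O> \<odot> I" using set_prodI[OF integers_1, of _ I] by auto
qed

text \<open>Every nonzero ideal is invertible, up to a principal factor, with its conjugate as inverse. The integers in
\<open>J \<odot> cnj ` J\<close> form an ideal of the integers; let \<open>g\<close> be its generator. It divides the norm of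
every element of \<open>J\<close>. For \<open>a\<close> and \<open>b\<close> in \<open>J\<close> it also divides the trace of
\<open>a * cnj b\<close>, which is a combination of the norms of \<open>a + b\<close>, \<open>a\<close> and \<open>b\<close>. Therefore
\<open>a * cnj b / g\<close> has integral trace and norm and is an algebraic integer.\<close>

lemma ideal_times_conjugate:
  assumes J: "fractional J" "J \<subseteq> \<O>" "J \<noteq> {0}"
  obtains g :: nat where "g > 0" "J \<odot> cnj ` J = (*) (of_nat g) ` \<O>"
proof -
  define M where "M = J \<odot> cnj ` J"
  have M: "fractional M" unfolding M_def by (intro fractional_set_prod fractional_cnj J)
  have norm: "x * cnj x \<in> M" if "x \<in> J" for x unfolding M_def using that by (intro set_prodI) auto
  define P where "P = (\<lambda>g::nat. g > 0 \<and> of_nat g \<in> M)"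
  have ex: "\<exists>g. P g"
  proof -
    obtain a where a: "a \<in> J" "a \<noteq> 0" using J(3) fractionalD(2)[OF J(1)] by blast
    have "a * cnj a \<in> \<int>" using a(1) J(2) integers_iff by blast
    then obtain k where k: "a * cnj a = of_int k" by (auto elim: Ints_cases)
    have "(cmod a)\<^sup>2 = of_int k"
      using k by (metis complex_norm_square of_real_eq_iff of_real_of_int_eq)
    hence "k > 0" using a(2) by (metis of_int_0_less_iff zero_less_norm_iff zero_less_power)
    hence "P (nat k)" unfolding P_def using k norm[OF a(1)] by simp
    thus ?thesis ..
  qed
  define g where "g = (LEAST g. P g)"
  have g: "P g" unfolding g_def using ex by (rule LeastI_ex)
  have gM: "of_nat g \<in> M" and g0: "g > 0" using g unfolding P_def by auto
  have dvd: "int g dvd k" if k: "of_int k \<in> M" for k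
  proof (rule ccontr)
    assume "\<not> int g dvd k"
    hence "k mod int g \<noteq> 0" by blast
    moreover have "k mod int g \<ge> 0" using g0 by simp
    ultimately have pos: "k mod int g > 0" by linarith
    have "of_int k + - (of_int (k div int g) * of_nat g) \<in> M"
      by (intro fractionalD(3)[OF M] fractional_uminus[OF M] fractionalD(4)[OF M] k gM integers_of_int)
    also have "of_int k + - (of_int (k div int g) * of_nat g) = (of_int (k mod int g) :: complex)"
      by (subst minus_div_mult_eq_mod[symmetric]) simp
    finally have "P (nat (k mod int g))" unfolding P_def using pos by simp
    hence "g \<le> nat (k mod int g)" unfolding g_def by (rule Least_le)
    moreover have "k mod int g < int g" using g0 by simp
    ultimately show False using pos by linarith
  qed
  have norm_div: "\<exists>k. x * cnj x = of_nat g * of_int k" if x: "x \<in> J" for x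
  proof -
    have "x * cnj x \<in> \<int>" using x J(2) integers_iff by blast
    then obtain k where k: "x * cnj x = of_int k" by (auto elim: Ints_cases)
    hence "int g dvd k" using dvd norm[OF x] by simp
    then obtain l where "k = int g * l" by (elim dvdE)
    thus ?thesis using k by auto
  qed
  have "M \<subseteq> (*) (of_nat g) ` \<O>"
    unfolding M_def
  proof (rule set_prod_subsetI)
    fix a b' assume a: "a \<in> J" and "b' \<in> cnj ` J"
    then obtain b where b: "b \<in> J" and b': "b' = cnj b" by blast
    obtain k where k: "a * cnj a = of_nat g * of_int k" using norm_div[OF a] by blast
    obtain l where l: "b * cnj b = of_nat g * of_int l" using norm_div[OF b] by blast
    obtain m where m: "(a + b) * cnj (a + b) = of_nat g * of_int m"
      using norm_div[OF fractionalD(3)[OF J(1) a b]] by blast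
    define z where "z = a * cnj b / of_nat g"
    have "a * cnj b + cnj (a * cnj b) = (a + b) * cnj (a + b) - a * cnj a - b * cnj b"
      by (simp add: algebra_simps)
    also have "\<dots> = of_nat g * of_int (m - k - l)" unfolding k l m by (simp add: algebra_simps)
    finally have "z + cnj z = of_int (m - k - l)" using g0 by (simp add: z_def field_simps)
    moreover have "z * cnj z = (a * cnj a) * (b * cnj b) / (of_nat g * of_nat g)"
      by (simp add: z_def)
    hence "z * cnj z = of_int (k * l)" using g0 by (simp add: k l)
    moreover have "z \<in> K" unfolding z_def
      by (intro divide_closed mult_closed cnj_closed of_nat_closed fractionalD(1)[OF J(1)] a b)
    ultimately have "z \<in> \<O>" unfolding integers_iff by (metis Ints_of_int)
    moreover have "a * b' = of_nat g * z" using g0 b' by (simp add: z_def)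
    ultimately show "a * b' \<in> (*) (of_nat g) ` \<O>" by blast
  next
    fix x y assume "x \<in> (*) (complex_of_nat g) ` \<O>" "y \<in> (*) (complex_of_nat g) ` \<O>"
    then obtain u v where "u \<in> \<O>" "v \<in> \<O>" "x = of_nat g * u" "y = of_nat g * v" by blast
    thus "x + y \<in> (*) (complex_of_nat g) ` \<O>" using integers_add[of u v] by (metis distrib_left imageI)
  qed
  moreover have "(*) (of_nat g) ` \<O> \<subseteq> M"
    using fractionalD(4)[OF M _ gM] by (auto simp: mult.commute)
  ultimately show ?thesis using that g0 unfolding M_def by blast
qed

abbreviation G where "G \<equiv> fractional_ideal_group K"

lemma carrier_G: "I \<in> carrier G \<longleftrightarrow> fractional I \<and> I \<noteq> {0}"
  by (simp add: fractional_ideal_group_def fractional_ideal_iff)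

lemma mult_G [simp]: "monoid.mult G = (\<odot>)"
  by (simp add: fractional_ideal_group_def)

lemma one_G [simp]: "one G = \<O>"
  by (simp add: fractional_ideal_group_def \<O>_def ring_of_integers_def)

lemma nonzero_element: "fractional I \<Longrightarrow> I \<noteq> {0} \<longleftrightarrow> (\<exists>x\<in>I. x \<noteq> 0)"
  using fractionalD(2) by blast

lemma inverse_exists:
  assumes A: "fractional A" "A \<noteq> {0}"
  obtains B where "fractional B" "B \<noteq> {0}" "B \<odot> A = \<O>"
proof -
  obtain c where c: "c \<in> \<O>" "c \<noteq> 0" "\<forall>x\<in>A. c * x \<in> \<O>" using A unfolding fractional_def by blast
  define J where "J = (*) c ` A"
  have J: "fractional J" "J \<subseteq> \<O>" "J \<noteq> {0}"
  proof -
    show J1: "fractional J" unfolding J_def by (intro fractional_scale A(1) c(2) integers_subset c(1))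
    show "J \<subseteq> \<O>" unfolding J_def using c(3) by auto
    obtain x where "x \<in> A" "x \<noteq> 0" using A nonzero_element by blast
    hence "c * x \<in> J" "c * x \<noteq> 0" unfolding J_def using c(2) by auto
    thus "J \<noteq> {0}" by blast
  qed
  obtain g :: nat where g: "g > 0" "J \<odot> cnj ` J = (*) (of_nat g) ` \<O>" 
    using ideal_times_conjugate[OF J] .
  define B where "B = (*) (c / of_nat g) ` (cnj ` J)"
  have B: "fractional B" unfolding B_def using c g
    by (intro fractional_scale fractional_cnj J divide_closed of_nat_closed) (auto intro: integers_subset)
  have "B \<odot> A = (*) (c / of_nat g) ` (A \<odot> cnj ` J)"
    unfolding B_def set_prod_scale by (simp add: set_prod_commute)
  also have "\<dots> = (*) (1 / of_nat g) ` ((*) c ` (A \<odot> cnj ` J))"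
    by (simp add: image_image)
  also have "\<dots> = (*) (1 / of_nat g) ` ((*) (of_nat g) ` \<O>)"
    using g(2) by (simp add: J_def set_prod_scale)
  also have "\<dots> = \<O>" using g(1) by (simp add: image_image)
  finally have *: "B \<odot> A = \<O>" .
  obtain x where "x \<in> J" "x \<noteq> 0" using J nonzero_element[OF J(1)] by blast
  hence "c / of_nat g * cnj x \<in> B" "c / of_nat g * cnj x \<noteq> 0" unfolding B_def using c g by auto
  hence "B \<noteq> {0}" by blast
  thus ?thesis using that * B by blast
qed

lemma comm_group_G: "comm_group G"
proof (rule comm_groupI)
  fix A B assume "A \<in> carrier G" "B \<in> carrier G"
  hence A: "fractional A" "A \<noteq> {0}" and B: "fractional B" "B \<noteq> {0}" by (auto simp: carrier_G)
  obtain a b where "a \<in> A" "a \<noteq> 0" "b \<in> B" "b \<noteq> 0" using A B nonzero_element by meson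
  hence "a * b \<in> A \<odot> B" "a * b \<noteq> 0" by (auto intro: set_prodI)
  hence "A \<odot> B \<noteq> {0}" by blast
  thus "A \<otimes>\<^bsub>G\<^esub> B \<in> carrier G" using fractional_set_prod A B by (simp add: carrier_G)
next
  have "\<O> \<noteq> {0}" using integers_1 by force
  thus "\<one>\<^bsub>G\<^esub> \<in> carrier G" using fractional_integers by (simp add: carrier_G)
next
  fix A assume "A \<in> carrier G"
  thus "\<one>\<^bsub>G\<^esub> \<otimes>\<^bsub>G\<^esub> A = A" by (simp add: carrier_G set_prod_integers)
next
  fix A assume "A \<in> carrier G"
  then obtain B where "fractional B" "B \<noteq> {0}" "B \<odot> A = \<O>" using inverse_exists carrier_G by metis
  thus "\<exists>B\<in>carrier G. B \<otimes>\<^bsub>G\<^esub> A = \<one>\<^bsub>G\<^esub>" by (auto simp: carrier_G intro: bexI[of _ B])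
next
  fix A B C
  show "A \<otimes>\<^bsub>G\<^esub> B \<otimes>\<^bsub>G\<^esub> C = A \<otimes>\<^bsub>G\<^esub> (B \<otimes>\<^bsub>G\<^esub> C)" by (simp add: set_prod_assoc)
  show "A \<otimes>\<^bsub>G\<^esub> B = B \<otimes>\<^bsub>G\<^esub> A" by (simp add: set_prod_commute)
qed

lemma principal_mem: "A \<in> principal_fractional_ideals K \<longleftrightarrow> (\<exists>a\<in>K. a \<noteq> 0 \<and> A = (*) a ` \<O>)"
  unfolding principal_fractional_ideals_def carrier_ring_of_integers by auto

lemma principal_mult: "(*) a ` \<O> \<odot> (*) b ` \<O> = (*) (a * b) ` \<O>"
proof -
  have "(*) a ` \<O> \<odot> (*) b ` \<O> = (*) a ` ((*) b ` (\<O> \<odot> \<O>))"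
    unfolding set_prod_scale by (subst set_prod_commute) (simp add: set_prod_scale)
  thus ?thesis by (simp add: set_prod_integers[OF fractional_integers] image_image mult.assoc)
qed

lemma principal_carrier:
  assumes "a \<in> K" "a \<noteq> 0" shows "(*) a ` \<O> \<in> carrier G"
proof -
  have "a * 1 \<in> (*) a ` \<O>" using integers_1 by blast
  hence "(*) a ` \<O> \<noteq> {0}" using assms by force
  thus ?thesis using fractional_scale[OF fractional_integers assms] by (simp add: carrier_G)
qed

lemma principal_subgroup: "subgroup (principal_fractional_ideals K) G"
proof -
  interpret G: comm_group G by (rule comm_group_G)
  show ?thesis
  proof (rule G.subgroupI)
    show "principal_fractional_ideals K \<subseteq> carrier G"
      by (rule subsetI) (metis principal_mem principal_carrier)
    have "(*) 1 ` \<O> \<in> principal_fractional_ideals K"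
      unfolding principal_mem using one_closed zero_neq_one by metis
    thus "principal_fractional_ideals K \<noteq> {}" by blast
  next
    fix A assume "A \<in> principal_fractional_ideals K"
    then obtain a where a: "a \<in> K" "a \<noteq> 0" "A = (*) a ` \<O>" unfolding principal_mem by blast
    have "(*) (inverse a) ` \<O> \<odot> A = \<O>" using a by (simp add: principal_mult)
    hence "inv\<^bsub>G\<^esub> A = (*) (inverse a) ` \<O>"
      using a inverse_closed by (intro G.inv_equality) (auto intro: principal_carrier)
    thus "inv\<^bsub>G\<^esub> A \<in> principal_fractional_ideals K"
      unfolding principal_mem using a inverse_closed nonzero_imp_inverse_nonzero by blast
  next
    fix A B assume "A \<in> principal_fractional_ideals K" "B \<in> principal_fractional_ideals K"
    then obtain a b where "a \<in> K" "a \<noteq> 0" "A = (*) a ` \<O>" "b \<in> K" "b \<noteq> 0" "B = (*) b ` \<O>"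
      unfolding principal_mem by blast
    thus "A \<otimes>\<^bsub>G\<^esub> B \<in> principal_fractional_ideals K"
      unfolding principal_mem by (intro bexI[of _ "a * b"]) (simp_all add: principal_mult mult_closed)
  qed
qed

lemma principal_pow: "((*) a ` \<O>) [^]\<^bsub>G\<^esub> (k::nat) = (*) (a ^ k) ` \<O>"
proof -
  interpret G: comm_group G by (rule comm_group_G)
  show ?thesis
  proof (induction k)
    case (Suc k)
    thus ?case by (simp only: G.nat_pow_Suc mult_G principal_mult power_Suc2)
  qed simp
qed

end

text \<open>The hypotheses say that the coset of \<open>x\<close> has order exactly \<open>n\<close>; as the order of an
element divides \<open>n\<close>, only the proper divisors of \<open>n\<close> have to be excluded. With the order of an infinite
group read as 0, the conclusion holds for infinite quotients as well.\<close>

lemma (in comm_group) dvd_order_FactGroup: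
  assumes H: "subgroup H G" and x: "x \<in> carrier G" and n: "(n::nat) > 0" "x [^] n \<in> H"
    and minimal: "\<And>r. 0 < r \<Longrightarrow> r < n \<Longrightarrow> r dvd n \<Longrightarrow> x [^] r \<notin> H"
  shows "n dvd Coset.order (G Mod H)"
proof -
  interpret normal H G using H by (simp add: normal_iff_subgroup)
  interpret Q: group "G Mod H" by (rule factorgroup_is_group)
  have car: "H #> x \<in> carrier (G Mod H)" using x by (simp add: carrier_FactGroup)
  have pow: "(H #> x) [^]\<^bsub>G Mod H\<^esub> k = \<one>\<^bsub>G Mod H\<^esub> \<longleftrightarrow> x [^] k \<in> H" for k :: nat
    using x H by (simp add: FactGroup_pow) (metis coset_join1 coset_join2 nat_pow_closed subset)
  have dvd: "Q.ord (H #> x) dvd n" using n(2) pow[of n] Q.pow_eq_id[OF car, of n] by simp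
  have "x [^] Q.ord (H #> x) \<in> H" using pow[of "Q.ord (H #> x)"] Q.pow_ord_eq_1[OF car] by simp
  moreover have "Q.ord (H #> x) > 0" using dvd n(1) by (rule dvd_pos_nat[rotated])
  ultimately have "\<not> Q.ord (H #> x) < n" using minimal dvd by blast
  moreover have "Q.ord (H #> x) \<le> n" using dvd n(1) by (rule dvd_imp_le)
  ultimately have "Q.ord (H #> x) = n" by simp
  thus ?thesis using Q.ord_dvd_group_order[OF car] by simp
qed

section \<open>Traces of powers\<close>

text \<open>The Lucas sequence \<open>V\<^sub>k(a, N)\<close>, that is, the sum of the \<open>k\<close>-th powers of the two roots of
\<open>X\<^sup>2 - a X + N\<close>.\<close>

fun lucas_V :: "int \<Rightarrow> int \<Rightarrow> nat \<Rightarrow> int" where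
  "lucas_V a N 0 = 2"
| "lucas_V a N (Suc 0) = a"
| "lucas_V a N (Suc (Suc k)) = a * lucas_V a N (Suc k) - N * lucas_V a N k"

lemma power_sum_eq_lucas_V:
  fixes x y :: complex
  assumes s: "x + y = of_int a" and p: "x * y = of_int N"
  shows "x ^ k + y ^ k = of_int (lucas_V a N k)"
  using s p
proof (induction a N k rule: lucas_V.induct)
  case (3 a N k)
  have "x ^ Suc (Suc k) + y ^ Suc (Suc k)
      = (x + y) * (x ^ Suc k + y ^ Suc k) - (x * y) * (x ^ k + y ^ k)"
    by (simp add: algebra_simps)
  thus ?case using 3 by simp
qed auto

lemma dvd_lucas_V: "odd k \<Longrightarrow> a dvd lucas_V a N k"
  by (induction a N k rule: lucas_V.induct) auto

text \<open>The first two terms of \<open>V\<close> as a polynomial in \<open>N\<close>; the shift of the index by 2 keeps the exponent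
of the second term a natural number.\<close>

lemma lucas_V_expansion:
  "\<exists>c. lucas_V a N (k + 2) = a ^ (k + 2) - int (k + 2) * a ^ k * N + c * N\<^sup>2"
proof (induction k rule: less_induct)
  case (less k)
  consider "k = 0" | "k = 1" | j where "k = Suc (Suc j)"
    by (metis One_nat_def not0_implies_Suc)
  thus ?case
  proof cases
    case 1
    show ?thesis by (rule exI[of _ 0]) (simp add: 1 eval_nat_numeral algebra_simps)
  next
    case 2
    show ?thesis by (rule exI[of _ 0]) (simp add: 2 eval_nat_numeral algebra_simps)
  next
    case (3 j)
    obtain c where c: "lucas_V a N (Suc j + 2) = a ^ (Suc j + 2) - int (Suc j + 2) * a ^ Suc j * N + c * N\<^sup>2"
      using less[of "Suc j"] 3 by auto
    obtain d where d: "lucas_V a N (j + 2) = a ^ (j + 2) - int (j + 2) * a ^ j * N + d * N\<^sup>2"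
      using less[of j] 3 by auto
    have "lucas_V a N (k + 2) = a * lucas_V a N (Suc j + 2) - N * lucas_V a N (j + 2)"
      by (simp add: 3)
    also have "\<dots> = a ^ (k + 2) - int (k + 2) * a ^ k * N + (a * c + int (j + 2) * a ^ j - N * d) * N\<^sup>2"
      unfolding c d by (simp add: 3 algebra_simps power2_eq_square)
    finally show ?thesis by blast
  qed
qed

text \<open>If the value were \<open>\<plusminus>t\<close>, then \<open>0 < \<bar>a\<bar> \<le> t\<close>, because \<open>a\<close> divides it. Modulo \<open>N\<close> the
value is \<open>a\<^sup>s\<close>; both are small against \<open>N\<close>, so they are equal. The next term of the expansion modulo
\<open>N\<^sup>2\<close> now has to vanish, so \<open>N\<close> divides \<open>s * a ^ (s - 2)\<close>, which is nonzero and of absolute value less than \<open>N\<close>.\<close>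

lemma abs_lucas_V_neq:
  fixes t n s :: nat
  assumes t: "t \<ge> 1" and s: "odd s" "3 \<le> s" "s \<le> n" and N: "int n * int t ^ n + int t < N"
  shows "\<bar>lucas_V a N s\<bar> \<noteq> int t"
proof
  assume eq: "\<bar>lucas_V a N s\<bar> = int t"
  obtain k where k: "s = k + 2" using s(2) by (metis add.commute le_Suc_ex numeral_3_eq_3 numeral_2_eq_2 Suc_leD)
  have "a dvd int t" using dvd_lucas_V[OF s(1), of a N] eq by (metis dvd_abs_iff)
  hence a: "\<bar>a\<bar> \<le> int t" "a \<noteq> 0" using t dvd_imp_le_int[of "int t" a] by auto
  have pow: "\<bar>a\<bar> ^ i \<le> int t ^ n" if "i \<le> n" for i
  proof -
    have "\<bar>a\<bar> ^ i \<le> int t ^ i" using a by (intro power_mono) auto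
    moreover have "int t ^ i \<le> int t ^ n" using t that by (intro power_increasing) auto
    ultimately show ?thesis by linarith
  qed
  have n1: "int t ^ n \<le> int n * int t ^ n" using s by (simp add: mult_le_cancel_right1)
  obtain c where c: "lucas_V a N s = a ^ s - int s * a ^ k * N + c * N\<^sup>2"
    using lucas_V_expansion[of a N k] k by auto
  have "a ^ s - lucas_V a N s = N * (int s * a ^ k - c * N)" unfolding c by (simp add: algebra_simps power2_eq_square)
  hence dvd: "N dvd a ^ s - lucas_V a N s" by simp
  have "\<bar>a ^ s - lucas_V a N s\<bar> \<le> \<bar>a\<bar> ^ s + int t" using eq by (simp flip: power_abs)
  also have "\<dots> < N" using pow[OF s(3)] n1 N by linarith
  finally have small: "\<bar>a ^ s - lucas_V a N s\<bar> < N" .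
  have "a ^ s = lucas_V a N s"
  proof (rule ccontr)
    assume "a ^ s \<noteq> lucas_V a N s"
    hence "\<bar>N\<bar> \<le> \<bar>a ^ s - lucas_V a N s\<bar>" using dvd by (intro dvd_imp_le_int) auto
    thus False using small by linarith
  qed
  hence "N * (int s * a ^ k - c * N) = 0" using c by (simp add: algebra_simps power2_eq_square)
  moreover have Npos: "N > 0" using small by linarith
  ultimately have "int s * a ^ k = c * N" by simp
  hence "N dvd int s * a ^ k" by simp
  moreover have "int s * a ^ k \<noteq> 0" using a(2) s(2) by simp
  ultimately have "\<bar>N\<bar> \<le> \<bar>int s * a ^ k\<bar>" by (intro dvd_imp_le_int)
  also have "\<dots> = int s * \<bar>a\<bar> ^ k" by (simp add: abs_mult power_abs)
  also have "\<dots> \<le> int n * int t ^ n" using pow[of k] k s(3) by (intro mult_mono) auto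
  finally have "\<bar>N\<bar> \<le> int n * int t ^ n" by simp
  thus False using N by linarith
qed

section \<open>An ideal class of prescribed order\<close>

context imaginary_quadratic begin

text \<open>The trace of such a unit is an integer between -2 and 2. The values \<open>\<plusminus>2\<close> belong to \<open>\<plusminus>1\<close>; the
others would put a square root of -1 or of -3 into the field.\<close>

lemma norm_one_integer:
  assumes u: "u \<in> \<O>" "u * cnj u = 1"
    and no_i: "\<And>x. x \<in> K \<Longrightarrow> x\<^sup>2 \<noteq> -1" and no_sqrt3: "\<And>x. x \<in> K \<Longrightarrow> x\<^sup>2 \<noteq> -3"
  shows "u = 1 \<or> u = -1"
proof -
  have uK: "u \<in> K" using u(1) by (rule integers_subset)
  have "u + cnj u \<in> \<int>" using u(1) integers_iff by blast
  then obtain k where k: "u + cnj u = of_int k" by (auto elim: Ints_cases)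
  have c: "cnj u = of_int k - u" using k by (simp add: algebra_simps)
  have quad: "u\<^sup>2 - of_int k * u + 1 = 0"
    using u(2) unfolding c by (simp add: algebra_simps power2_eq_square)
  have "(cmod u)\<^sup>2 = 1" using u(2) by (metis complex_norm_square of_real_eq_1_iff)
  hence "cmod u = 1" by (simp add: power2_eq_1_iff) (smt (verit) norm_ge_zero)
  hence "\<bar>Re u\<bar> \<le> 1" using abs_Re_le_cmod[of u] by simp
  moreover have "2 * Re u = of_int k" using arg_cong[OF k, of Re] by simp
  ultimately have "\<bar>of_int k :: real\<bar> \<le> 2" by linarith
  hence "\<bar>k\<bar> \<le> 2" by linarith
  hence "k \<in> {-2, -1, 0, 1, 2}" by auto
  moreover have "k \<noteq> 0"
  proof
    assume "k = 0"
    hence "u\<^sup>2 = -1" using quad by (simp add: eq_neg_iff_add_eq_0)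
    thus False using no_i uK by blast
  qed
  moreover have sq: "(2 * u - of_int k)\<^sup>2 = of_int (k\<^sup>2 - 4)"
  proof -
    have "(2 * u - of_int k)\<^sup>2 = 4 * (u\<^sup>2 - of_int k * u + 1) + of_int k ^ 2 - 4"
      by (simp add: algebra_simps power2_eq_square)
    thus ?thesis using quad by simp
  qed
  moreover have mem: "2 * u - of_int k \<in> K"
    using uK of_int_closed[of 2] of_int_closed[of k] by (intro diff_closed mult_closed) auto
  have "k \<noteq> 1" "k \<noteq> -1" using sq no_sqrt3[OF mem] by auto
  ultimately consider "k = 2" | "k = -2" by auto
  thus ?thesis
  proof cases
    case 1
    thus ?thesis using sq by simp
  next
    case 2
    hence "2 * u + 2 = 0" using sq by simp
    hence "2 * (u + 1) = 0" by simp
    hence "u + 1 = 0" by (simp only: mult_eq_0_iff) simp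
    thus ?thesis by (simp add: eq_neg_iff_add_eq_0)
  qed
qed

text \<open>Trace and norm of \<open>\<alpha>\<close> are coprime, so \<open>\<alpha>\<close> and its conjugate have no common ideal factor although
their product is an \<open>n\<close>-th power. Hence \<open>\<alpha>\<close> generates the \<open>n\<close>-th power of an ideal, namely
of \<open>I = (\<alpha>, y)\<close>, whose norm is \<open>y\<close>. If a smaller power \<open>I\<^sup>r\<close> with \<open>n = r * s\<close> were
generated by some \<open>\<beta>\<close>, then \<open>\<alpha> = \<plusminus>\<beta>\<^sup>s\<close>, and the small trace \<open>t\<close> of \<open>\<alpha>\<close> would contradict
\<open>abs_lucas_V_neq\<close>. So the class of \<open>I\<close> has order \<open>n\<close>.\<close>

lemma dvd_class_number:
  fixes t y n :: nat
  assumes \<alpha>: "\<alpha> \<in> K" and trace: "\<alpha> + cnj \<alpha> = of_nat t" and norm: "\<alpha> * cnj \<alpha> = of_nat y ^ n"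
    and t: "t \<ge> 1" and "gcd t y = 1" and n: "odd n" and large: "n * t ^ n + t < y"
    and no_i: "\<And>x. x \<in> K \<Longrightarrow> x\<^sup>2 \<noteq> -1" and no_sqrt3: "\<And>x. x \<in> K \<Longrightarrow> x\<^sup>2 \<noteq> -3"
  shows "n dvd class_number K"
proof -
  interpret G: comm_group G by (rule comm_group_G)
  define Y :: complex where "Y = of_nat y"
  have Y0: "Y \<noteq> 0" and y0: "y > 0" using large by (auto simp: Y_def)
  have n0: "n > 0" using n by (rule odd_pos)
  have \<alpha>O: "\<alpha> \<in> \<O>" unfolding integers_iff using \<alpha> trace norm by simp
  have norm': "\<alpha> * cnj \<alpha> = Y ^ n" using norm by (simp add: Y_def)
  have \<alpha>0: "\<alpha> \<noteq> 0" using norm' Y0 by auto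
  have YO: "Y ^ k \<in> \<O>" for k using integers_of_int[of "int (y ^ k)"] by (simp add: Y_def)
  have YO1: "Y \<in> \<O>" using YO[of 1] by simp
  have cnjY: "cnj Y = Y" by (simp add: Y_def)
  note mem = integers_add integers_mult integers_cnj YO YO1 \<alpha>O integers_0 integers_1
  \<comment> \<open>The ideal generated by \<open>\<alpha>\<close> and \<open>c\<close>, for \<open>c\<close> a power of \<open>y\<close>: the power
    \<open>I\<^sup>k\<close> lies in \<open>gen (Y\<^sup>k)\<close>, which for \<open>k = n\<close> is the ideal generated by \<open>\<alpha>\<close>.\<close>
  define gen where "gen = (\<lambda>c. {\<alpha> * u + c * v |u v. u \<in> \<O> \<and> v \<in> \<O>})"
  define I where "I = gen Y"
  have genI: "\<alpha> * u + c * v \<in> gen c" if "u \<in> \<O>" "v \<in> \<O>" for u v c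
    using that unfolding gen_def by blast
  have genE: "\<exists>u\<in>\<O>. \<exists>v\<in>\<O>. x = \<alpha> * u + c * v" if "x \<in> gen c" for x c
    using that unfolding gen_def by blast
  have gen_add: "x + y \<in> gen c" if xy: "x \<in> gen c" "y \<in> gen c" for x y c
  proof -
    obtain u v where 1: "u \<in> \<O>" "v \<in> \<O>" "x = \<alpha> * u + c * v" using genE[OF xy(1)] by blast
    obtain u' v' where 2: "u' \<in> \<O>" "v' \<in> \<O>" "y = \<alpha> * u' + c * v'" using genE[OF xy(2)] by blast
    have "x + y = \<alpha> * (u + u') + c * (v + v')" by (simp add: 1 2 algebra_simps)
    thus ?thesis using genI 1 2 integers_add by metis
  qed
  have gen_O: "gen (Y ^ k) \<subseteq> \<O>" for k using mem by (auto simp: gen_def)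
  have IO: "I \<subseteq> \<O>" using gen_O[of 1] by (simp add: I_def)
  have \<alpha>I: "\<alpha> \<in> I" using genI[of 1 0 Y] mem by (simp add: I_def)
  have YI: "Y \<in> I" using genI[of 0 1 Y] mem by (simp add: I_def)
  have I: "fractional I"
  proof -
    have "r * x \<in> I" if r: "r \<in> \<O>" and x: "x \<in> I" for r x
    proof -
      obtain u v where 1: "u \<in> \<O>" "v \<in> \<O>" "x = \<alpha> * u + Y * v" using genE x unfolding I_def by blast
      have "r * x = \<alpha> * (r * u) + Y * (r * v)" by (simp add: 1 algebra_simps)
      thus ?thesis using genI 1 r integers_mult unfolding I_def by metis
    qed
    moreover have "0 \<in> I" using genI[of 0 0 Y] mem by (simp add: I_def)
    ultimately show ?thesis unfolding fractional_def
      using IO integers_subset gen_add[of _ Y] integers_1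
      by (intro conjI ballI bexI[of _ 1]) (auto simp: I_def)
  qed
  have carI: "I \<in> carrier G" using I YI Y0 by (auto simp: carrier_G)
  have carI': "cnj ` I \<in> carrier G"
    using fractional_cnj[OF I] YI Y0 cnjY by (force simp: carrier_G)

  have norm_I: "I \<odot> cnj ` I = (*) Y ` \<O>"
  proof
    show "I \<odot> cnj ` I \<subseteq> (*) Y ` \<O>"
    proof (rule set_prod_subsetI)
      fix a b' assume a: "a \<in> I" and "b' \<in> cnj ` I"
      then obtain b where b: "b \<in> I" "b' = cnj b" by blast
      obtain u v where 1: "u \<in> \<O>" "v \<in> \<O>" "a = \<alpha> * u + Y * v" using genE a unfolding I_def by blast
      obtain u' v' where 2: "u' \<in> \<O>" "v' \<in> \<O>" "b = \<alpha> * u' + Y * v'" using genE b unfolding I_def by blast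
      have "a * b' = (\<alpha> * cnj \<alpha>) * (u * cnj u') + Y * (\<alpha> * u * cnj v' + cnj \<alpha> * cnj u' * v + Y * v * cnj v')"
        by (simp add: 1 2 b(2) cnjY algebra_simps)
      also have "\<alpha> * cnj \<alpha> = Y * Y ^ (n - 1)" using n0 norm' by (simp flip: power_Suc)
      finally have "a * b' = Y * (Y ^ (n - 1) * (u * cnj u') + (\<alpha> * u * cnj v' + cnj \<alpha> * cnj u' * v + Y * v * cnj v'))"
        by (simp add: algebra_simps)
      moreover have "Y ^ (n - 1) * (u * cnj u') + (\<alpha> * u * cnj v' + cnj \<alpha> * cnj u' * v + Y * v * cnj v') \<in> \<O>"
        by (intro mem 1 2)
      ultimately show "a * b' \<in> (*) Y ` \<O>" by blast
    next
      fix x y assume "x \<in> (*) Y ` \<O>" "y \<in> (*) Y ` \<O>"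
      then obtain u v where "u \<in> \<O>" "v \<in> \<O>" "x = Y * u" "y = Y * v" by blast
      thus "x + y \<in> (*) Y ` \<O>" using integers_add[of u v] by (metis distrib_left imageI)
    qed
    have P: "fractional (I \<odot> cnj ` I)" by (intro fractional_set_prod fractional_cnj I)
    \<comment> \<open>Coprimality enters here: \<open>Y\<close> times an integral combination of the trace and \<open>Y\<close> is a sum
      of products of generators.\<close>
    have "gcd (int t) (int y) = 1" using \<open>gcd t y = 1\<close> by (metis gcd_int_int_eq of_nat_1)
    then obtain p q where pq: "p * int t + q * int y = 1" by (metis bezout_int)
    have "of_int p * (\<alpha> * cnj Y + Y * cnj \<alpha>) + of_int q * (Y * cnj Y) \<in> I \<odot> cnj ` I"
      using YI \<alpha>I
      by (intro fractionalD(3)[OF P] fractionalD(4)[OF P] integers_of_int set_prodI imageI)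
    also have "of_int p * (\<alpha> * cnj Y + Y * cnj \<alpha>) + of_int q * (Y * cnj Y)
        = Y * (of_int p * (\<alpha> + cnj \<alpha>) + of_int q * Y)" by (simp add: cnjY algebra_simps)
    also have "\<dots> = Y * of_int (p * int t + q * int y)" unfolding trace by (simp add: Y_def)
    finally have "Y \<in> I \<odot> cnj ` I" by (simp add: pq)
    thus "(*) Y ` \<O> \<subseteq> I \<odot> cnj ` I"
      using fractionalD(4)[OF P] by (auto simp: mult.commute)
  qed

  have pow_sub: "I [^]\<^bsub>G\<^esub> k \<subseteq> gen (Y ^ k)" for k :: nat
  proof (induction k)
    case 0
    show ?case using genI[of 0 _ 1] mem by auto
  next
    case (Suc k)
    have "I [^]\<^bsub>G\<^esub> k \<odot> I \<subseteq> gen (Y ^ Suc k)"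
    proof (rule set_prod_subsetI)
      fix a b assume "a \<in> I [^]\<^bsub>G\<^esub> k" and b: "b \<in> I"
      hence a: "a \<in> gen (Y ^ k)" using Suc by blast
      obtain u v where 1: "u \<in> \<O>" "v \<in> \<O>" "a = \<alpha> * u + Y ^ k * v" using genE a by blast
      obtain u' v' where 2: "u' \<in> \<O>" "v' \<in> \<O>" "b = \<alpha> * u' + Y * v'" using genE b unfolding I_def by blast
      have "a * b = \<alpha> * (u * (\<alpha> * u' + Y * v') + Y ^ k * v * u') + Y ^ Suc k * (v * v')"
        by (simp add: 1 2 algebra_simps)
      moreover have "u * (\<alpha> * u' + Y * v') + Y ^ k * v * u' \<in> \<O>" "v * v' \<in> \<O>"
        by (intro mem 1 2)+
      ultimately show "a * b \<in> gen (Y ^ Suc k)" using genI by metis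
    qed (rule gen_add)
    thus ?case by simp
  qed
  have pow_cnj: "cnj ` (I [^]\<^bsub>G\<^esub> k) = (cnj ` I) [^]\<^bsub>G\<^esub> k" for k :: nat
  proof (induction k)
    case 0
    have "cnj ` \<O> = \<O>" using integers_cnj by (auto intro!: image_eqI[of _ cnj "cnj _"])
    thus ?case by simp
  qed (simp add: set_prod_cnj)

  have In: "I [^]\<^bsub>G\<^esub> n = (*) \<alpha> ` \<O>"
  proof
    define P where "P = I [^]\<^bsub>G\<^esub> n"
    have P: "fractional P" using G.nat_pow_closed[OF carI] unfolding P_def by (simp add: carrier_G)
    show sub: "P \<subseteq> (*) \<alpha> ` \<O>"
    proof
      fix x assume "x \<in> P"
      hence "x \<in> gen (Y ^ n)" using pow_sub unfolding P_def by blast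
      then obtain u v where 1: "u \<in> \<O>" "v \<in> \<O>" "x = \<alpha> * u + Y ^ n * v" using genE by blast
      have "x = \<alpha> * (u + cnj \<alpha> * v)" unfolding 1 norm'[symmetric] by (simp add: algebra_simps)
      moreover have "u + cnj \<alpha> * v \<in> \<O>" by (intro mem 1)
      ultimately show "x \<in> (*) \<alpha> ` \<O>" by blast
    qed
    \<comment> \<open>The converse inclusion comes from norms: \<open>\<alpha> * cnj \<alpha>\<close> lies in \<open>P \<odot> cnj ` P\<close>, hence in
      \<open>cnj \<alpha>\<close> times \<open>P\<close>, and \<open>cnj \<alpha>\<close> can be cancelled.\<close>
    have "P \<odot> cnj ` P = (I \<odot> cnj ` I) [^]\<^bsub>G\<^esub> n"
      using G.pow_mult_distrib[OF _ carI carI', of n] G.m_comm[OF carI carI']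
      by (simp add: P_def pow_cnj)
    also have "\<dots> = (*) (Y ^ n) ` \<O>" unfolding norm_I by (rule principal_pow)
    finally have "Y ^ n * 1 \<in> P \<odot> cnj ` P" using integers_1 by blast
    moreover have "cnj ` P \<subseteq> (*) (cnj \<alpha>) ` \<O>" using sub integers_cnj by fastforce
    hence "P \<odot> cnj ` P \<subseteq> P \<odot> (*) (cnj \<alpha>) ` \<O>" by (intro set_prod_mono) auto
    moreover have "P \<odot> (*) (cnj \<alpha>) ` \<O> = (*) (cnj \<alpha>) ` P"
      by (subst set_prod_commute) (simp add: set_prod_scale set_prod_integers[OF P])
    ultimately have "Y ^ n * 1 \<in> (*) (cnj \<alpha>) ` P" by blast
    then obtain p where p: "p \<in> P" "\<alpha> * cnj \<alpha> = cnj \<alpha> * p" using norm' by auto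
    hence "p = \<alpha>" using \<alpha>0 by simp
    thus "(*) \<alpha> ` \<O> \<subseteq> P" using p(1) fractionalD(4)[OF P] by (auto simp: mult.commute)
  qed

  have "n dvd Coset.order (G Mod principal_fractional_ideals K)"
  proof (rule G.dvd_order_FactGroup[OF principal_subgroup carI n0])
    show "I [^]\<^bsub>G\<^esub> n \<in> principal_fractional_ideals K"
      unfolding principal_mem In using \<alpha> \<alpha>0 by blast
  next
    fix r assume r: "0 < r" "r < n" "r dvd n"
    obtain s where s: "n = r * s" using r(3) by (elim dvdE)
    have sodd: "odd s" using n s by simp
    have "s \<noteq> 1" using r(2) s by auto
    hence s3: "3 \<le> s" using sodd by (cases s rule: nat.exhaust) (auto elim!: oddE)
    have sn: "s \<le> n" using s r(1) by simp
    show "I [^]\<^bsub>G\<^esub> r \<notin> principal_fractional_ideals K"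
    proof
      assume "I [^]\<^bsub>G\<^esub> r \<in> principal_fractional_ideals K"
      then obtain \<beta> where \<beta>: "\<beta> \<in> K" "\<beta> \<noteq> 0" "I [^]\<^bsub>G\<^esub> r = (*) \<beta> ` \<O>" unfolding principal_mem by blast
      have "\<beta> * 1 \<in> I [^]\<^bsub>G\<^esub> r" using \<beta>(3) integers_1 by blast
      hence \<beta>O: "\<beta> \<in> \<O>" using pow_sub[of r] gen_O[of r] by auto
      have "(*) \<alpha> ` \<O> = (I [^]\<^bsub>G\<^esub> r) [^]\<^bsub>G\<^esub> s"
        using In s G.nat_pow_pow[OF carI] by simp
      also have "\<dots> = (*) (\<beta> ^ s) ` \<O>" unfolding \<beta>(3) by (rule principal_pow)
      finally have eq: "(*) \<alpha> ` \<O> = (*) (\<beta> ^ s) ` \<O>" .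
      \<comment> \<open>\<open>\<alpha>\<close> and \<open>\<beta>\<^sup>s\<close> generate the same ideal, so they differ by a unit \<open>u\<close>, whose norm is 1.\<close>
      have "\<alpha> * 1 \<in> (*) (\<beta> ^ s) ` \<O>" using eq integers_1 by blast
      then obtain u where u: "u \<in> \<O>" "\<alpha> = \<beta> ^ s * u" by auto
      have "\<beta> ^ s * 1 \<in> (*) \<alpha> ` \<O>" using eq integers_1 by blast
      then obtain w where w: "w \<in> \<O>" "\<beta> ^ s = \<alpha> * w" by auto
      have "\<alpha> * (u * w) = \<alpha> * 1" using u(2) w(2) by (simp add: mult_ac)
      hence uw: "u * w = 1" using \<alpha>0 by (metis mult_left_cancel)
      obtain Nu Nw where Nu: "u * cnj u = of_int Nu" and Nw: "w * cnj w = of_int Nw"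
        using u(1) w(1) unfolding integers_iff by (auto elim!: Ints_cases)
      have "of_int (Nu * Nw) = (u * w) * cnj (u * w)" by (simp flip: Nu Nw)
      also have "\<dots> = of_int 1" unfolding uw by simp
      finally have "Nu * Nw = 1" by (simp only: of_int_eq_iff)
      moreover have "Nu \<ge> 0"
      proof -
        have "(cmod u)\<^sup>2 = of_int Nu"
          using Nu by (metis complex_norm_square of_real_eq_iff of_real_of_int_eq)
        thus ?thesis by (metis of_int_0_le_iff zero_le_power2)
      qed
      ultimately have "Nu = 1" by (auto simp: zmult_eq_1_iff)
      hence uunit: "u = 1 \<or> u = -1" using norm_one_integer[OF u(1) _ no_i no_sqrt3] Nu by simp
      \<comment> \<open>The norm of \<open>\<beta>\<close> is the positive \<open>s\<close>-th root of \<open>y\<^sup>n\<close>, that is \<open>y\<^sup>r\<close>.\<close>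
      obtain a N where a: "\<beta> + cnj \<beta> = of_int a" and N: "\<beta> * cnj \<beta> = of_int N"
        using \<beta>O unfolding integers_iff by (auto elim!: Ints_cases)
      have "(\<beta> * cnj \<beta>) ^ s * (u * cnj u) = \<alpha> * cnj \<alpha>"
        by (simp add: u(2) power_mult_distrib)
      hence "of_int (N ^ s) = (of_int (int y ^ n) :: complex)"
        using Nu \<open>Nu = 1\<close> norm by (simp add: N)
      hence "N ^ s = (int y ^ r) ^ s" by (simp only: of_int_eq_iff s power_mult)
      moreover have "N \<ge> 0"
      proof -
        have "(cmod \<beta>)\<^sup>2 = of_int N"
          using N by (metis complex_norm_square of_real_eq_iff of_real_of_int_eq)
        thus ?thesis by (metis of_int_0_le_iff zero_le_power2)
      qed
      ultimately have Ny: "N = int y ^ r" using s3 by (intro power_eq_imp_eq_base[of N s]) auto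
      have "int y ^ 1 \<le> int y ^ r" using y0 r(1) by (intro power_increasing) auto
      moreover have "int (n * t ^ n + t) < int y" using large by (simp only: of_nat_less_iff)
      hence "int n * int t ^ n + int t < int y" by simp
      ultimately have "int n * int t ^ n + int t < N" unfolding Ny power_one_right by linarith
      hence neq: "\<bar>lucas_V a N s\<bar> \<noteq> int t" using abs_lucas_V_neq t sodd s3 sn by blast
      have tr: "\<beta> ^ s + cnj \<beta> ^ s = of_int (lucas_V a N s)"
        by (rule power_sum_eq_lucas_V[OF a N])
      have "of_int (lucas_V a N s) = (of_int (int t) :: complex) \<or> of_int (lucas_V a N s) = (of_int (- int t) :: complex)"
        using uunit
      proof
        assume "u = 1"
        thus ?thesis using trace u(2) tr by simp
      next
        assume "u = -1"
        hence "- (\<beta> ^ s + cnj \<beta> ^ s) = of_nat t" using trace u(2) by simp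
        thus ?thesis using tr by (metis minus_minus of_int_minus of_int_of_nat_eq)
      qed
      hence "lucas_V a N s = int t \<or> lucas_V a N s = - int t" by (simp only: of_int_eq_iff)
      thus False using neq by auto
    qed
  qed
  thus ?thesis by (simp add: class_number_def ideal_class_group_def)
qed

end

section \<open>The fields generated by square roots of negative integers\<close>

lemma quadratic_field_subfield: "complex_subfield (quadratic_field D)"
proof
  show "1 \<in> quadratic_field D"
    using generate_field.one[of complex_field] by (simp add: quadratic_field_def)
  show "x - y \<in> quadratic_field D" if "x \<in> quadratic_field D" "y \<in> quadratic_field D" for x y
    using generate_field.eng_add[of x complex_field _ "- y"] generate_field.a_inv[of y complex_field] that
    by (simp add: quadratic_field_def)
  show "x * y \<in> quadratic_field D" if "x \<in> quadratic_field D" "y \<in> quadratic_field D" for x y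
    using generate_field.eng_mult[of x complex_field _ y] that by (simp add: quadratic_field_def)
  show "inverse x \<in> quadratic_field D" if "x \<in> quadratic_field D" for x
    using generate_field.m_inv[of x complex_field] that complex_field_m_inv[of x]
    by (cases "x = 0") (simp_all add: quadratic_field_def)
qed

lemma csqrt_in_quadratic_field: "csqrt (of_int D) \<in> quadratic_field D"
  by (simp add: quadratic_field_def generate_field.incl)

lemma complex_subfield_imp_subfield:
  assumes "complex_subfield E" shows "subfield E complex_field"
proof -
  interpret E: complex_subfield E by fact
  show ?thesis
  proof (rule field.subfieldI'[OF field_from_type_algebra])
    show "subring E complex_field"
      by (rule complex_field.subringI) (auto intro: E.one_closed E.uminus_closed E.mult_closed E.add_closed)
    show "inv\<^bsub>complex_field\<^esub> k \<in> E" if "k \<in> E - {\<zero>\<^bsub>complex_field\<^esub>}" for k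
      using that E.inverse_closed by (simp add: complex_field_m_inv)
  qed
qed

lemma csqrt_negative_int:
  assumes "D < (0::int)"
  shows "Re (csqrt (of_int D)) = 0" "Im (csqrt (of_int D)) \<noteq> 0"
    "cnj (csqrt (of_int D)) = - csqrt (of_int D)"
proof -
  have eq: "csqrt (of_int D) = \<i> * of_real (sqrt \<bar>of_int D\<bar>)"
    using assms by (subst csqrt_of_real_nonpos) auto
  show "Re (csqrt (of_int D)) = 0" "Im (csqrt (of_int D)) \<noteq> 0"
    "cnj (csqrt (of_int D)) = - csqrt (of_int D)"
    unfolding eq using assms by auto
qed

lemma quadratic_field_eq:
  assumes D: "D < 0"
  shows "quadratic_field D = {a + b * csqrt (of_int D) |a b. a \<in> \<rat> \<and> b \<in> \<rat>}"
proof -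
  define w where "w = csqrt (of_int D)"
  define E where "E = {a + b * w |a b. a \<in> \<rat> \<and> b \<in> \<rat>}"
  have w2: "w * w = of_int D" using power2_csqrt[of "of_int D"] by (simp add: w_def power2_eq_square)
  note w = csqrt_negative_int[OF D, folded w_def]
  have mem: "a + b * w \<in> E" if "a \<in> \<rat>" "b \<in> \<rat>" for a b
    using that by (auto simp: E_def)
  have "complex_subfield E"
  proof
    show "1 \<in> E" using mem[of 1 0] by simp
  next
    fix x y assume "x \<in> E" "y \<in> E"
    then obtain a b c d where xy: "x = a + b * w" "y = c + d * w"
      and rat: "a \<in> \<rat>" "b \<in> \<rat>" "c \<in> \<rat>" "d \<in> \<rat>"
      unfolding E_def by blast
    have "x - y = (a - c) + (b - d) * w" by (simp add: xy algebra_simps)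
    also have "\<dots> \<in> E" by (intro mem Rats_diff rat)
    finally show "x - y \<in> E" .
    have "x * y = (a * c + b * d * (w * w)) + (a * d + b * c) * w" by (simp add: xy algebra_simps)
    also have "\<dots> \<in> E" unfolding w2 by (intro mem Rats_add Rats_mult rat Rats_of_int)
    finally show "x * y \<in> E" .
  next
    fix x assume "x \<in> E"
    then obtain a b where x: "x = a + b * w" and rat: "a \<in> \<rat>" "b \<in> \<rat>" unfolding E_def by blast
    define q where "q = a * a - b * b * of_int D"
    have q: "q \<in> \<rat>" using rat by (simp add: q_def)
    have ra: "cnj a = a" "cnj b = b" using rat by (auto elim!: Rats_cases')
    have "x * cnj x = a * a - b * b * (w * w)" by (simp add: x ra w algebra_simps)
    hence N: "x * cnj x = q" unfolding w2 by (simp add: q_def)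
    have "inverse x = cnj x / q"
      by (cases "x = 0") (simp_all flip: N add: field_simps)
    also have "\<dots> = a / q + (- b / q) * w" by (simp add: x ra w diff_divide_distrib)
    also have "\<dots> \<in> E" by (intro mem Rats_divide Rats_minus_iff[THEN iffD2] rat q)
    finally show "inverse x \<in> E" .
  qed
  moreover have "w \<in> E" using mem[of 0 1] by simp
  ultimately have "quadratic_field D \<subseteq> E"
    unfolding quadratic_field_def
    by (intro field.generate_field_min_subfield1[OF field_from_type_algebra] complex_subfield_imp_subfield)
      (auto simp: w_def)
  moreover interpret Q: complex_subfield "quadratic_field D" by (rule quadratic_field_subfield)
  have "w \<in> quadratic_field D" unfolding w_def by (rule csqrt_in_quadratic_field)
  hence "E \<subseteq> quadratic_field D" unfolding E_def using Q.add_closed Q.mult_closed Q.Rats_closed by blast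
  ultimately show ?thesis by (simp add: E_def w_def)
qed

lemma quadratic_field_imaginary_quadratic:
  assumes D: "D < 0" shows "imaginary_quadratic (quadratic_field D)"
proof -
  interpret Q: complex_subfield "quadratic_field D" by (rule quadratic_field_subfield)
  show ?thesis
  proof
    fix x assume "x \<in> quadratic_field D"
    then obtain a b where x: "x = a + b * csqrt (of_int D)" "a \<in> \<rat>" "b \<in> \<rat>"
      unfolding quadratic_field_eq[OF D] by blast
    have ra: "cnj a = a" "cnj b = b" "a \<in> \<real>" "b \<in> \<real>" using x by (auto elim!: Rats_cases')
    have "cnj x = a + (- b) * csqrt (of_int D)" by (simp add: x ra csqrt_negative_int[OF D])
    thus "cnj x \<in> quadratic_field D"
      unfolding quadratic_field_eq[OF D] using x(2,3) by fastforce
    show "x \<in> \<rat>" if "x \<in> \<real>"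
    proof -
      have "Im x = 0" using that by (simp add: complex_is_Real_iff)
      moreover have "Im x = Re b * Im (csqrt (of_int D))"
        using ra by (simp add: x complex_is_Real_iff)
      ultimately have "Re b = 0" using csqrt_negative_int[OF D] by simp
      hence "b = 0" using ra by (simp add: complex_eq_iff complex_is_Real_iff)
      thus ?thesis using x by simp
    qed
  qed
qed

lemma imaginary_quadratic_field_quadratic_field:
  assumes D: "D < 0" shows "imaginary_quadratic_field (quadratic_field D)"
proof -
  define w where "w = csqrt (of_int D)"
  note w = csqrt_negative_int[OF D, folded w_def]
  have nr: "w \<notin> \<real>" using w by (simp add: complex_is_Real_iff)
  have "complex_subfield \<rat>" by standard auto
  hence Q: "subfield \<rat> complex_field" by (rule complex_subfield_imp_subfield)
  have "ring.dimension complex_field (Suc 1) \<rat> (ring.line_extension complex_field \<rat> w \<rat>)"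
    by (rule complex_field.Suc_dim) (use nr complex_field.dimension_one[OF Q] in \<open>auto elim!: Rats_cases'\<close>)
  moreover have "ring.line_extension complex_field \<rat> w \<rat> = quadratic_field D"
    unfolding quadratic_field_eq[OF D]
    by (auto simp: complex_field.line_extension_mem_iff w_def) (metis add.commute)+
  moreover have "\<not> quadratic_field D \<subseteq> \<real>" using nr csqrt_in_quadratic_field unfolding w_def by blast
  ultimately show ?thesis
    using complex_subfield_imp_subfield[OF quadratic_field_subfield]
    by (simp add: imaginary_quadratic_field_def numeral_2_eq_2)
qed

text \<open>The element \<open>x\<close> is purely imaginary, so it is a rational multiple of the square root of \<open>D\<close>. This
single fact serves to exclude square roots of -1 and -3 and to tell two quadratic fields apart.\<close>

lemma negative_square_in_quadratic_field:
  assumes D: "D < 0" and x: "x \<in> quadratic_field D" "x\<^sup>2 = - of_int c" and c: "c > 0"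
  shows "\<exists>k::int. c * (- D) = k\<^sup>2"
proof -
  define w where "w = csqrt (of_int D)"
  note w = csqrt_negative_int[OF D, folded w_def]
  have w2: "w\<^sup>2 = of_int D" by (simp add: w_def)
  obtain a b where ab: "x = a + b * w" "a \<in> \<rat>" "b \<in> \<rat>"
    using x(1) unfolding quadratic_field_eq[OF D] w_def by blast
  have ra: "Im a = 0" "Im b = 0" using ab(2,3) by (auto elim!: Rats_cases')
  have re: "Re x = Re a" and im: "Im x = Re b * Im w" by (simp_all add: ab(1) ra w)
  have "Im (x\<^sup>2) = 0" "Re (x\<^sup>2) < 0" unfolding x(2) using c by auto
  hence "Re x * Im x = 0" and less: "(Re x)\<^sup>2 < (Im x)\<^sup>2" by (auto simp: power2_eq_square)
  hence "Re x = 0 \<or> Im x = 0" by simp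
  hence "Re x = 0" using less by auto
  hence "a = 0" using re ra by (simp add: complex_eq_iff)
  hence b: "b\<^sup>2 * of_int D = - of_int c" using x(2) by (simp add: ab(1) power_mult_distrib w2)
  have "(b * of_int D)\<^sup>2 = (b\<^sup>2 * of_int D) * of_int D" by (simp add: power2_eq_square)
  hence sq: "(b * of_int D)\<^sup>2 = of_int (c * (- D))" unfolding b by simp
  have "algebraic_int (b * of_int D)"
    by (rule root_monic_quadratic[of 0 "- of_int (c * (- D))"]) (use sq in auto)
  hence "b * of_int D \<in> \<int>" using ab(3) by (intro rational_algebraic_int_is_int) auto
  then obtain k where "b * of_int D = of_int k" by (auto elim: Ints_cases)
  hence "(of_int (k\<^sup>2) :: complex) = of_int (c * (- D))" using sq by simp
  thus ?thesis by (metis of_int_eq_iff)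
qed

lemma quadratic_field_eq_imp_square:
  assumes "D < 0" "D' < 0" "quadratic_field D = quadratic_field D'"
  shows "\<exists>k::int. D * D' = k\<^sup>2"
proof -
  define x where "x = csqrt (of_int D)"
  have "x \<in> quadratic_field D'" using csqrt_in_quadratic_field assms(3) unfolding x_def by blast
  moreover have "x\<^sup>2 = - of_int (- D)" by (simp add: x_def)
  ultimately have "\<exists>k::int. - D * - D' = k\<^sup>2"
    using assms by (intro negative_square_in_quadratic_field) auto
  thus ?thesis by simp
qed

text \<open>The element \<open>\<alpha> = (t + w) / 2\<close> has trace \<open>t\<close> and norm \<open>y\<^sup>n\<close>. The integer \<open>D\<close> may differ from
\<open>t\<^sup>2 - 4 y\<^sup>n\<close> by a square factor; the first field of a tuple needs this freedom.\<close>

lemma dvd_class_number_quadratic_field: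
  fixes t y n :: nat
  assumes D: "D < 0" and w: "w \<in> quadratic_field D" "w\<^sup>2 = of_int ((int t)\<^sup>2 - 4 * int y ^ n)"
    and neg: "(int t)\<^sup>2 < 4 * int y ^ n"
    and t: "t \<ge> 1" "gcd t y = 1" and n: "odd n" and large: "n * t ^ n + t < y"
    and no_square: "\<And>k::int. - D \<noteq> k\<^sup>2" "\<And>k::int. 3 * (- D) \<noteq> k\<^sup>2"
  shows "n dvd class_number (quadratic_field D)"
proof -
  interpret K: imaginary_quadratic "quadratic_field D"
    using D by (rule quadratic_field_imaginary_quadratic)
  have "Re (w\<^sup>2) = (real t)\<^sup>2 - 4 * real y ^ n" "Im (w\<^sup>2) = 0" unfolding w(2) by simp_all
  moreover have "(real t)\<^sup>2 < 4 * real y ^ n"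
  proof -
    have "real_of_int ((int t)\<^sup>2) < real_of_int (4 * int y ^ n)" using neg by (simp only: of_int_less_iff)
    thus ?thesis by simp
  qed
  ultimately have "Re w * Im w = 0" and less: "(Re w)\<^sup>2 < (Im w)\<^sup>2" by (auto simp: power2_eq_square)
  hence "Re w = 0 \<or> Im w = 0" by simp
  hence "Re w = 0" using less by auto
  hence cw: "cnj w = - w" by (simp add: complex_eq_iff)
  define \<alpha> where "\<alpha> = (of_nat t + w) / 2"
  have "\<alpha> \<in> quadratic_field D"
    unfolding \<alpha>_def using K.of_nat_closed[of 2] by (intro K.divide_closed K.add_closed K.of_nat_closed w) simp
  moreover have "\<alpha> + cnj \<alpha> = of_nat t" by (simp add: \<alpha>_def cw field_simps)
  moreover have "\<alpha> * cnj \<alpha> = ((of_nat t)\<^sup>2 - w\<^sup>2) / 4"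
    by (simp add: \<alpha>_def cw power2_eq_square field_simps)
  hence "\<alpha> * cnj \<alpha> = of_nat y ^ n" unfolding w(2) by simp
  moreover have "x\<^sup>2 \<noteq> - 1" if "x \<in> quadratic_field D" for x
    using negative_square_in_quadratic_field[OF D that, of 1] no_square(1) by auto
  moreover have "x\<^sup>2 \<noteq> - 3" if "x \<in> quadratic_field D" for x
    using negative_square_in_quadratic_field[OF D that, of 3] no_square(2) by auto
  ultimately show ?thesis by (rule K.dvd_class_number[OF _ _ _ t n large])
qed

section \<open>Congruences that exclude squares\<close>

lemma odd_power_mod:
  fixes y :: int
  assumes "odd n"
  shows "y mod 4 = 3 \<Longrightarrow> y ^ n mod 4 = 3" "y mod 3 = 2 \<Longrightarrow> y ^ n mod 3 = 2"
proof -
  obtain k where n: "n = Suc (2 * k)" using assms by (auto elim!: oddE)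
  have ev: "z ^ (2 * k) mod c = 1 mod c" if "(z * z) mod c = 1 mod c" for z c :: int
    using that by (metis power_mod power_mult power_one power2_eq_square)
  show "y ^ n mod 4 = 3" if y: "y mod 4 = 3"
  proof -
    have "y * y mod 4 = 1 mod 4" using mod_mult_eq[of y 4 y] y by simp
    from ev[OF this] show ?thesis using mod_mult_eq[of y 4 "y ^ (2 * k)"] y by (simp add: n)
  qed
  show "y ^ n mod 3 = 2" if y: "y mod 3 = 2"
  proof -
    have "y * y mod 3 = 1 mod 3" using mod_mult_eq[of y 3 y] y by simp
    from ev[OF this] show ?thesis using mod_mult_eq[of y 3 "y ^ (2 * k)"] y by (simp add: n)
  qed
qed

lemma square_mod_4: "(x::int)\<^sup>2 mod 4 = (if even x then 0 else 1)"
proof (cases "even x")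
  case True
  then obtain a where "x = 2 * a" by (elim evenE)
  hence "x\<^sup>2 = 4 * a\<^sup>2" by (simp add: power2_eq_square)
  thus ?thesis using True by simp
next
  case False
  then obtain a where "x = 2 * a + 1" by (elim oddE)
  hence "x\<^sup>2 = 1 + 4 * (a\<^sup>2 + a)" by (simp add: power2_eq_square algebra_simps)
  thus ?thesis using False by (simp only: mod_mult_self2) simp
qed

lemma square_mod_3: "(x::int)\<^sup>2 mod 3 = 0 \<or> x\<^sup>2 mod 3 = 1"
proof -
  have "x mod 3 = 0 \<or> x mod 3 = 1 \<or> x mod 3 = 2" by presburger
  moreover have "x\<^sup>2 mod 3 = (x mod 3)\<^sup>2 mod 3" by (simp add: power_mod)
  ultimately show ?thesis by auto
qed

text \<open>Reducing \<open>t\<^sup>2 + k\<^sup>2 = 4 N\<close> modulo 4 makes \<open>t\<close> and \<open>k\<close> even, and then \<open>N\<close> is itself a sum of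
two squares.\<close>

lemma square_neq_if_3_mod_4:
  fixes N t k :: int
  assumes N: "N mod 4 = 3" shows "4 * N - t\<^sup>2 \<noteq> k\<^sup>2"
proof
  assume "4 * N - t\<^sup>2 = k\<^sup>2"
  hence eq: "t\<^sup>2 + k\<^sup>2 = 4 * N" by simp
  have "(t\<^sup>2 mod 4 + k\<^sup>2 mod 4) mod 4 = 0" unfolding mod_add_eq eq by simp
  hence "even t" "even k" by (auto simp: square_mod_4 split: if_splits)
  then obtain a b where "t = 2 * a" "k = 2 * b" by (elim evenE)
  hence "a\<^sup>2 + b\<^sup>2 = N" using eq by (simp add: power2_eq_square)
  hence "(a\<^sup>2 mod 4 + b\<^sup>2 mod 4) mod 4 = 3" using N unfolding mod_add_eq by simp
  thus False by (auto simp: square_mod_4 split: if_splits)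
qed

text \<open>A square divisible by 3 is divisible by 9, so 3 would divide \<open>4 N - t\<^sup>2\<close> and \<open>t\<^sup>2\<close> would be 2 modulo 3.\<close>

lemma square_neq_triple_if_2_mod_3:
  fixes N t k :: int
  assumes N: "N mod 3 = 2" shows "3 * (4 * N - t\<^sup>2) \<noteq> k\<^sup>2"
proof
  assume eq: "3 * (4 * N - t\<^sup>2) = k\<^sup>2"
  hence "k\<^sup>2 mod 3 = 0" by (metis mod_mult_self1_is_0)
  hence "(k mod 3)\<^sup>2 mod 3 = 0" by (simp add: power_mod)
  moreover have "k mod 3 = 0 \<or> k mod 3 = 1 \<or> k mod 3 = 2" by presburger
  ultimately have "k mod 3 = 0" by auto
  then obtain l where "k = 3 * l" by (metis mod_0_imp_dvd dvdE)
  hence "4 * N - t\<^sup>2 = 3 * l\<^sup>2" using eq by (simp add: power2_eq_square)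
  thus False using N square_mod_3[of t] by presburger
qed

section \<open>Choice of the parameter and the infinite family\<close>

text \<open>The tuples belong to \<open>d = - 4 y\<^sup>n\<close> with \<open>y = base n z\<close>; the form of \<open>y\<close> makes the field of
\<open>d\<close>, which is that of \<open>-y\<close>, the field of \<open>1 - 4 z\<^sup>n\<close>.\<close>

definition base :: "nat \<Rightarrow> nat \<Rightarrow> nat" where
  "base n z = 4 * z ^ n - 1"

lemma base_int: "z > 0 \<Longrightarrow> int (base n z) = 4 * int z ^ n - 1"
  by (simp add: base_def of_nat_diff)

text \<open>The factors of the modulus of \<open>z\<close> have separate purposes. The factor 3 gives \<open>y \<equiv> 2\<close> modulo 3, so that no field of the tuple contains
a square root of -3; a square root of -1 is excluded by \<open>y \<equiv> 3\<close> modulo 4. The factorial makes \<open>y\<close> prime to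
every \<open>i\<close> between 1 and \<open>m\<close>. The last factor makes \<open>z\<close>, and with it \<open>y\<close>, large enough.\<close>

lemma tuple_divisible:
  fixes n m z :: nat
  assumes n: "n \<ge> 3" "odd n" and m: "m \<ge> 1" and z: "z > 0" "3 * fact m * (n * m ^ n + m + 1) dvd z" and i: "i \<le> m"
  defines "d \<equiv> - 4 * int (base n z) ^ n"
  shows "d + (int i)\<^sup>2 < 0" "n dvd class_number (quadratic_field (d + (int i)\<^sup>2))"
proof -
  define y where "y = base n z"
  have y: "int y = 4 * int z ^ n - 1" unfolding y_def using z(1) by (rule base_int)
  have B: "n * m ^ n + m < z"
  proof -
    have "n * m ^ n + m + 1 dvd z" using z(2) by (rule dvd_mult_right)
    hence "n * m ^ n + m + 1 \<le> z" using z(1) by (rule dvd_imp_le)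
    thus ?thesis by simp
  qed
  hence mz: "m < z" by (rule le_less_trans[rotated]) simp
  have zn: "int z \<le> int z ^ n" using z(1) n by (intro self_le_power) auto
  have zy: "int z < int y" using y zn z(1) by linarith
  have zdvd: "int z dvd int z ^ n" using n by (intro dvd_power) simp
  have "4 dvd int y + 1" by (simp add: y)
  have "3 dvd 3 * fact m * (n * m ^ n + m + 1)" by (simp only: mult.assoc dvd_triv_left)
  hence "3 dvd z" using z(2) by (rule dvd_trans)
  hence "int 3 dvd int z" by (simp only: int_dvd_int_iff)
  hence "3 dvd int z ^ n" using zdvd by (simp add: dvd_trans)
  have y4: "int y mod 4 = 3" using \<open>4 dvd int y + 1\<close> by presburger
  have y3: "int y mod 3 = 2" using \<open>3 dvd int z ^ n\<close> y by presburger
  note N4 = odd_power_mod(1)[OF n(2) y4] and N3 = odd_power_mod(2)[OF n(2) y3]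
  have d: "d = - 4 * int y ^ n" by (simp add: d_def y_def)
  have iy: "int i < int y" using i mz zy by linarith
  have "(int i)\<^sup>2 \<le> (int y)\<^sup>2" using iy by (intro power_mono) auto
  moreover have "(int y)\<^sup>2 \<le> int y ^ n" using n iy by (intro power_increasing) auto
  moreover have "int y ^ n > 0" using iy by simp
  ultimately have lt: "(int i)\<^sup>2 < 4 * int y ^ n" by linarith
  thus neg: "d + (int i)\<^sup>2 < 0" by (simp add: d)
  have E: "- (d + (int i)\<^sup>2) = 4 * int y ^ n - (int i)\<^sup>2" by (simp add: d)
  note sq = square_neq_if_3_mod_4[OF N4, of "int i", folded E] square_neq_triple_if_2_mod_3[OF N3, of "int i", folded E]
  define w where "w = csqrt (of_int (d + (int i)\<^sup>2))"
  have w: "w \<in> quadratic_field (d + (int i)\<^sup>2)" "w\<^sup>2 = of_int (d + (int i)\<^sup>2)"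
    unfolding w_def by (rule csqrt_in_quadratic_field, rule power2_csqrt)
  show "n dvd class_number (quadratic_field (d + (int i)\<^sup>2))"
  proof (cases "i = 0")
    case False
    have "i dvd fact m" using False i by (intro dvd_fact) auto
    hence "i dvd z" using z(2) by (meson dvd_mult dvd_mult2 dvd_trans)
    hence "int i dvd int z" by (simp only: int_dvd_int_iff)
    hence "int i dvd 4 * int z ^ n" using zdvd by (intro dvd_mult) (rule dvd_trans)
    hence "int i dvd int y + 1" by (simp add: y)
    hence "gcd (int i) (int y) dvd int y + 1" by (rule dvd_trans[OF gcd_dvd1])
    moreover have "gcd (int i) (int y) dvd int y" by (rule gcd_dvd2)
    ultimately have "gcd (int i) (int y) dvd 1" by (simp only: dvd_add_right_iff)
    hence cop: "gcd i y = 1" by (simp add: gcd_int_int_eq)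
    have "n * i ^ n + i \<le> n * m ^ n + m" using i by (intro add_mono mult_le_mono2 power_mono) auto
    also note B
    also have "z < y" using zy by simp
    finally have "n * i ^ n + i < y" .
    \<comment> \<open>For positive \<open>i\<close>, the number \<open>d + i\<^sup>2\<close> already has the form \<open>t\<^sup>2 - 4 y\<^sup>n\<close> with \<open>t = i\<close>.\<close>
    with w neg cop sq lt n False show ?thesis
      by (intro dvd_class_number_quadratic_field[where w = w and t = i and y = y]) (auto simp: d)
  next
    case True
    \<comment> \<open>As \<open>n\<close> is odd, \<open>- 4 y\<^sup>n\<close> is \<open>-y = 1 - 4 z\<^sup>n\<close> times a square, so trace 1 and base \<open>z\<close> apply.\<close>
    define h where "h = (n - 1) div 2"
    have h: "n = 2 * h + 1" unfolding h_def using n by (auto elim!: oddE)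
    define v where "v = w / (2 * of_nat y ^ h)"
    interpret K: complex_subfield "quadratic_field (d + (int i)\<^sup>2)" by (rule quadratic_field_subfield)
    have y0: "of_nat y \<noteq> (0 :: complex)" using iy by auto
    have "v = w / of_nat (2 * y ^ h)" by (simp add: v_def)
    hence "v \<in> quadratic_field (d + (int i)\<^sup>2)" using w(1) K.of_nat_closed K.divide_closed by metis
    moreover have "v\<^sup>2 = of_int ((int 1)\<^sup>2 - 4 * int z ^ n)"
    proof -
      have "v\<^sup>2 = w\<^sup>2 / (4 * of_nat y ^ (2 * h))"
        by (simp add: v_def power_divide power_mult_distrib power_mult[symmetric] mult.commute)
      also have "w\<^sup>2 = - 4 * of_nat y ^ n" unfolding w(2) by (simp add: d True)
      also have "\<dots> / (4 * of_nat y ^ (2 * h)) = - of_nat y" using y0 by (simp add: h)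
      also have "\<dots> = - of_int (int y)" by simp
      also have "\<dots> = of_int ((int 1)\<^sup>2 - 4 * int z ^ n)" unfolding y by simp
      finally show ?thesis .
    qed
    moreover have "(int 1)\<^sup>2 < 4 * int z ^ n" unfolding of_nat_1 power_one using zn z(1) by linarith
    moreover have "n * 1 ^ n + 1 < z"
    proof -
      have "n * 1 ^ n + 1 \<le> n * m ^ n + m" using m by (intro add_mono mult_le_mono2 power_mono) auto
      also note B
      finally show ?thesis .
    qed
    ultimately show ?thesis
      by (intro dvd_class_number_quadratic_field[where w = v and t = 1 and y = z]) (use neg sq n in auto)
  qed
qed

text \<open>Multiplying by \<open>base n z\<close> at each step makes every base divide all later parameters, hence
makes the bases pairwise coprime.\<close>

fun parameter_seq :: "nat \<Rightarrow> nat \<Rightarrow> nat \<Rightarrow> nat" where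
  "parameter_seq n M 0 = M"
| "parameter_seq n M (Suc j) = parameter_seq n M j * base n (parameter_seq n M j)"

text \<open>With \<open>b = base n z\<close>, the number \<open>b\<close> is odd and prime to \<open>z\<close>, hence to \<open>a\<close>. If the two fields were equal,
the product of the radicands would be a square, and by coprimality \<open>b\<^sup>n\<close> would be one. But
\<open>b\<^sup>n \<equiv> 3\<close> modulo 4.\<close>

lemma quadratic_field_base_neq:
  assumes n: "n > 0" "odd n" and a: "a > 0" "a dvd z" and z: "z > 0"
  shows "quadratic_field (- 4 * int a ^ n) \<noteq> quadratic_field (- 4 * int (base n z) ^ n)"
proof
  define b where "b = base n z"
  have b: "int b = 4 * int z ^ n - 1" unfolding b_def using z by (rule base_int)
  have "int z ^ n > 0" using z by simp
  hence b0: "b > 0" using b by linarith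
  assume "quadratic_field (- 4 * int a ^ n) = quadratic_field (- 4 * int (base n z) ^ n)"
  then obtain k :: int where "(- 4 * int a ^ n) * (- 4 * int b ^ n) = k\<^sup>2"
    using quadratic_field_eq_imp_square[of "- 4 * int a ^ n" "- 4 * int b ^ n"] a b0 unfolding b_def by auto
  hence "int ((16 * a ^ n) * b ^ n) = int ((nat \<bar>k\<bar>)\<^sup>2)" by simp
  hence "(16 * a ^ n) * b ^ n = (nat \<bar>k\<bar>)\<^sup>2" by (simp only: of_nat_eq_iff)
  hence sq: "is_nth_power 2 ((16 * a ^ n) * b ^ n)" by (metis is_nth_power_def)
  have "Rings.coprime (2 * int a) (int b)"
  proof (rule coprimeI)
    fix c assume c: "c dvd 2 * int a" "c dvd int b"
    have "2 * int a dvd 2 * int z" using a(2) by simp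
    hence "c dvd 2 * int z" using c(1) by (rule dvd_trans[rotated])
    moreover have "2 * int z dvd 4 * int z ^ n" using n by (intro mult_dvd_mono dvd_power) auto
    ultimately have "c dvd 4 * int z ^ n" by (rule dvd_trans)
    hence "c dvd int b + 1" by (simp add: b)
    thus "is_unit c" using c(2) by (simp only: dvd_add_right_iff)
  qed
  hence cop: "Rings.coprime (2 * a) b" by (metis coprime_int_iff of_nat_mult of_nat_numeral)
  hence "Rings.coprime (16 * a ^ n) (b ^ n)"
    by (simp add: coprime_power_left_iff coprime_power_right_iff) 
       (use coprime_power_left_iff[of 2 4 b] in auto)
  hence "is_nth_power 2 (b ^ n)"
    using is_nth_power_mult_coprime_natD(2)[OF _ sq] a b0 by simp
  then obtain l where l: "b ^ n = l\<^sup>2" by (auto elim: is_nth_powerE)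
  have "int b mod 4 = 3" unfolding b by presburger
  hence "int b ^ n mod 4 = 3" by (rule odd_power_mod(1)[OF n(2)])
  moreover have "int b ^ n = (int l)\<^sup>2" using l by (metis of_nat_power)
  ultimately show False using square_mod_4[of "int l"] by (simp split: if_splits)
qed

theorem theorem3:
  fixes n m :: nat
  assumes "n \<ge> 3" and "odd n" and "m \<ge> 1"
  shows "infinite {map (\<lambda>i. quadratic_field (d + (int i)\<^sup>2)) [0..<m + 1] | d :: int.
           (\<forall>i\<le>m. imaginary_quadratic_field (quadratic_field (d + (int i)\<^sup>2))) \<and>
           (\<forall>i\<le>m. n dvd class_number (quadratic_field (d + (int i)\<^sup>2)))}" (is "infinite ?S")
proof -
  define M where "M = 3 * fact m * (n * m ^ n + m + 1)"
  define Z where "Z = parameter_seq n M"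
  define d where "d = (\<lambda>j. - 4 * int (base n (Z j)) ^ n)"
  define F where "F = (\<lambda>j. map (\<lambda>i. quadratic_field (d j + (int i)\<^sup>2)) [0..<m + 1])"
  have base_pos: "base n z > 0" if "z > 0" for z
  proof -
    have "z ^ n \<ge> 1" using that by simp
    thus ?thesis unfolding base_def by linarith
  qed
  have Z: "Z j > 0 \<and> M dvd Z j" for j
    by (induction j) (auto simp: Z_def M_def base_pos)
  have dvd: "base n (Z j) dvd Z k" if "j < k" for j k
    using that by (induction k) (auto simp: Z_def less_Suc_eq)
  have "F j \<in> ?S" for j
  proof -
    have "d j + (int i)\<^sup>2 < 0 \<and> n dvd class_number (quadratic_field (d j + (int i)\<^sup>2))" if "i \<le> m" for i
      using tuple_divisible[of n m "Z j" i] assms Z[of j] that unfolding M_def d_def by simp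
    thus ?thesis unfolding F_def using imaginary_quadratic_field_quadratic_field by blast
  qed
  hence "range F \<subseteq> ?S" by blast
  moreover have neq: "F j \<noteq> F k" if "j < k" for j k
  proof
    assume "F j = F k"
    hence "F j ! 0 = F k ! 0" by simp
    hence "quadratic_field (d j) = quadratic_field (d k)" by (simp add: F_def nth_append del: upt_Suc)
    thus False
      unfolding d_def using quadratic_field_base_neq[of n "base n (Z j)" "Z k"] assms Z base_pos dvd[OF that]
      by simp
  qed
  have "inj F" by (rule linorder_injI) (rule neq)
  ultimately show ?thesis using range_inj_infinite infinite_super by blast
qed

end
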